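(* Let $G$ be a unimodular locally compact second countable group and let $G^\delta$ denote the underlying discrete group. If there exists an integrable transverse $G$-system $(X,\mu,Y)$ whose return time set $\Lambda(Y)=\{g\in G: gY\cap Y\ne\emptyset\}$ is discrete, then the discretization map $\mathrm{H}_{\mathrm{cb}}^\bullet(G;\mathbb R)\to \mathrm{H}_{\mathrm b}^\bullet(G^\delta;\mathbb R)$ is injective.
   Context: Let $G$ act by a probability measure preserving Borel action on a standard Borel probability space $(X,\mu)$. For a Borel set $Y\subset X$ and $x\in X$ put $Y_x=\{g\in G: gx\in Y\}$. $Y$ is a cross section if $GY=X$ and each $Y_x$ is locally finite ($|Y_x\cap L|<\infty$ for all compact $L\subset G$); then $(X,\mu,Y)$ is a transverse $G$-system. It is integrable if $\int_X |Y_x\cap L|\,d\mu(x)<\infty$ for every compact $L\subset G$. The discretization map is the natural map from continuous bounded cohomology of $G$ to bounded cohomology of the discrete group $G^\delta$ (both with trivial real coefficients), induced by regarding a continuous bounded cochain on $G$ as a bounded cochain on $G^\delta$. *)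

theory Defs
  imports "HOL-Probability.Probability_Measure" "HOL-Algebra.Coset"
begin

text \<open>
  Groups are written additively, because the topological groups of the library are the types of
  class \<open>topological_group_add\<close>. Neither this class nor \<open>group_add\<close> assumes commutativity.
\<close>

section \<open>Unimodular groups\<close>

text \<open>On a locally compact second countable Hausdorff group, a Borel measure that is finite on
  compact sets is automatically regular, so these are exactly the left Haar measures.\<close>

definition left_haar_measure :: "'g::topological_group_add measure \<Rightarrow> bool" where
  "left_haar_measure m \<longleftrightarrow>
     sets m = sets borel \<and>
     emeasure m UNIV \<noteq> 0 \<and>
     (\<forall>K. compact K \<longrightarrow> emeasure m K < \<infinity>) \<and>
     (\<forall>g. distr m borel (\<lambda>x. g + x) = m)"

definition unimodular :: "'g::topological_group_add itself \<Rightarrow> bool" where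
  "unimodular _ \<longleftrightarrow>
     (\<exists>m :: 'g measure. left_haar_measure m \<and> (\<forall>g. distr m borel (\<lambda>x. x + g) = m))"

section \<open>Transverse systems\<close>

definition standard_borel :: "'x measure \<Rightarrow> bool" where
  "standard_borel M \<longleftrightarrow>
     (\<exists>T. completely_metrizable_space T \<and> second_countable T \<and> topspace T = space M \<and>
          sets M = sigma_sets (space M) {U. openin T U})"

definition pmp_action :: "('g::topological_group_add \<Rightarrow> 'x \<Rightarrow> 'x) \<Rightarrow> 'x measure \<Rightarrow> bool" where
  "pmp_action act M \<longleftrightarrow>
     standard_borel M \<and> prob_space M \<and>
     (\<lambda>(g, x). act g x) \<in> borel \<Otimes>\<^sub>M M \<rightarrow>\<^sub>M M \<and>
     (\<forall>x\<in>space M. act 0 x = x) \<and>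
     (\<forall>g h. \<forall>x\<in>space M. act (g + h) x = act g (act h x)) \<and>
     (\<forall>g. distr M M (act g) = M)"

definition hitting_times :: "('g \<Rightarrow> 'x \<Rightarrow> 'x) \<Rightarrow> 'x set \<Rightarrow> 'x \<Rightarrow> 'g set" where
  "hitting_times act Y x = {g. act g x \<in> Y}"

definition cross_section ::
    "('g::topological_group_add \<Rightarrow> 'x \<Rightarrow> 'x) \<Rightarrow> 'x measure \<Rightarrow> 'x set \<Rightarrow> bool" where
  "cross_section act M Y \<longleftrightarrow>
     Y \<in> sets M \<and>
     (\<Union>g. act g ` Y) = space M \<and>
     (\<forall>x\<in>space M. \<forall>L. compact L \<longrightarrow> finite (hitting_times act Y x \<inter> L))"

definition transverse_system ::
    "('g::topological_group_add \<Rightarrow> 'x \<Rightarrow> 'x) \<Rightarrow> 'x measure \<Rightarrow> 'x set \<Rightarrow> bool" where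
  "transverse_system act M Y \<longleftrightarrow> pmp_action act M \<and> cross_section act M Y"

text \<open>By the Lusin-Novikov theorem the counting function below is Borel measurable for every
  transverse system of a locally compact second countable Hausdorff group, so the measurability
  contained in \<open>integrable\<close> is no additional condition.\<close>

definition integrable_transverse_system ::
    "('g::topological_group_add \<Rightarrow> 'x \<Rightarrow> 'x) \<Rightarrow> 'x measure \<Rightarrow> 'x set \<Rightarrow> bool" where
  "integrable_transverse_system act M Y \<longleftrightarrow>
     transverse_system act M Y \<and>
     (\<forall>L. compact L \<longrightarrow> integrable M (\<lambda>x. real (card (hitting_times act Y x \<inter> L))))"

definition return_times :: "('g \<Rightarrow> 'x \<Rightarrow> 'x) \<Rightarrow> 'x set \<Rightarrow> 'g set" where
  "return_times act Y = {g. act g ` Y \<inter> Y \<noteq> {}}"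

section \<open>Continuous bounded cohomology\<close>

text \<open>
  Continuous bounded cohomology with trivial real coefficients is the cohomology of the complex of
  invariant continuous bounded homogeneous cochains. The topology is an explicit argument, so that
  the underlying discrete group is obtained from the discrete topology on the same type.
  An $(n+1)$-tuple is an extensional function on the index set \<open>{..n}\<close>, and a cochain is a
  function extended by 0 outside the tuples, so that it is determined by its values on tuples.
\<close>

definition tuples :: "nat \<Rightarrow> (nat \<Rightarrow> 'g) set" where
  "tuples n = ({..n} \<rightarrow>\<^sub>E UNIV)"

definition bounded_cochains :: "'g::group_add topology \<Rightarrow> nat \<Rightarrow> ((nat \<Rightarrow> 'g) \<Rightarrow> real) set" where
  "bounded_cochains T n =
     {f. continuous_map (product_topology (\<lambda>_. T) {..n}) euclideanreal f \<and>
         bounded (range f) \<and>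
         (\<forall>x. x \<notin> tuples n \<longrightarrow> f x = 0) \<and>
         (\<forall>g. \<forall>x\<in>tuples n. f (\<lambda>j\<in>{..n}. g + x j) = f x)}"

definition omit :: "nat \<Rightarrow> nat \<Rightarrow> (nat \<Rightarrow> 'g) \<Rightarrow> nat \<Rightarrow> 'g" where
  "omit n i x = (\<lambda>j\<in>{..n}. x (if j < i then j else Suc j))"

definition coboundary :: "nat \<Rightarrow> ((nat \<Rightarrow> 'g) \<Rightarrow> real) \<Rightarrow> (nat \<Rightarrow> 'g) \<Rightarrow> real" where
  "coboundary n f =
     (\<lambda>x. if x \<in> tuples (Suc n) then \<Sum>i\<le>Suc n. (-1) ^ i * f (omit n i x) else 0)"

definition bounded_cocycles :: "'g::group_add topology \<Rightarrow> nat \<Rightarrow> ((nat \<Rightarrow> 'g) \<Rightarrow> real) set" where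
  "bounded_cocycles T n = {f \<in> bounded_cochains T n. coboundary n f = (\<lambda>_. 0)}"

definition bounded_coboundaries ::
    "'g::group_add topology \<Rightarrow> nat \<Rightarrow> ((nat \<Rightarrow> 'g) \<Rightarrow> real) set" where
  "bounded_coboundaries T n =
     (case n of 0 \<Rightarrow> {\<lambda>_. 0} | Suc m \<Rightarrow> coboundary m ` bounded_cochains T m)"

definition cocycle_group :: "'g::group_add topology \<Rightarrow> nat \<Rightarrow> ((nat \<Rightarrow> 'g) \<Rightarrow> real) monoid" where
  "cocycle_group T n =
     \<lparr>carrier = bounded_cocycles T n, monoid.mult = (\<lambda>f h x. f x + h x), one = (\<lambda>_. 0)\<rparr>"

definition cb_cohomology ::
    "'g::group_add topology \<Rightarrow> nat \<Rightarrow> ((nat \<Rightarrow> 'g) \<Rightarrow> real) set monoid" where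
  "cb_cohomology T n = cocycle_group T n Mod bounded_coboundaries T n"

text \<open>The union runs over cosets that all coincide (see \<open>discretization_class\<close> below): the class
  of \<open>f\<close> in the cohomology of \<open>T\<close> is sent to the class of \<open>f\<close> in that of the discrete group.\<close>

definition discretization ::
    "nat \<Rightarrow> ((nat \<Rightarrow> 'g::group_add) \<Rightarrow> real) set \<Rightarrow> ((nat \<Rightarrow> 'g) \<Rightarrow> real) set" where
  "discretization n A =
     (\<Union>f\<in>A. bounded_coboundaries (discrete_topology UNIV) n
               #>\<^bsub>cocycle_group (discrete_topology UNIV) n\<^esub> f)"

subsection \<open>Well-definedness\<close>

lemma product_topology_discrete_tuples:
  "product_topology (\<lambda>_. discrete_topology (UNIV :: 'g set)) {..n} = discrete_topology (tuples n)"
proof -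
  have "openin (product_topology (\<lambda>_. discrete_topology (UNIV :: 'g set)) {..n}) {x}"
    if "x \<in> tuples n" for x
  proof -
    have "{x} = (\<Pi>\<^sub>E i\<in>{..n}. {x i})"
      using that PiE_singleton[of x "{..n}"] by (simp add: tuples_def PiE_iff)
    moreover have "openin (product_topology (\<lambda>_. discrete_topology (UNIV :: 'g set)) {..n})
        (\<Pi>\<^sub>E i\<in>{..n}. {x i})"
      by (subst openin_PiE) auto
    ultimately show ?thesis
      by simp
  qed
  then have "discrete_topology (tuples n) =
      product_topology (\<lambda>_. discrete_topology (UNIV :: 'g set)) {..n}"
    by (subst discrete_topology_unique) (simp add: tuples_def)
  then show ?thesis
    by (rule sym)
qed

lemma bounded_cochains_discrete:
  "bounded_cochains (discrete_topology UNIV) n =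
     {f. bounded (range f) \<and> (\<forall>x. x \<notin> tuples n \<longrightarrow> f x = 0) \<and>
         (\<forall>g. \<forall>x\<in>tuples n. f (\<lambda>j\<in>{..n}. g + x j) = f x)}"
  by (simp add: bounded_cochains_def product_topology_discrete_tuples)

lemma bounded_cochains_subset_discrete:
  "bounded_cochains T n \<subseteq> bounded_cochains (discrete_topology UNIV) n"
  unfolding bounded_cochains_discrete by (auto simp: bounded_cochains_def)

lemma bounded_cocycles_subset_discrete:
  "bounded_cocycles T n \<subseteq> bounded_cocycles (discrete_topology UNIV) n"
  using bounded_cochains_subset_discrete by (auto simp: bounded_cocycles_def)

lemma bounded_coboundaries_subset_discrete:
  "bounded_coboundaries T n \<subseteq> bounded_coboundaries (discrete_topology UNIV) n"
  using bounded_cochains_subset_discrete[of T "n - 1"]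
  by (cases n) (auto simp: bounded_coboundaries_def)

lemma omit_in_tuples [simp]: "omit n i x \<in> tuples n"
  by (simp add: omit_def tuples_def)

lemma omit_translate:
  assumes "i \<le> Suc n"
  shows "omit n i (\<lambda>j\<in>{..Suc n}. g + x j) = (\<lambda>j\<in>{..n}. g + omit n i x j)"
  using assms by (auto simp: omit_def fun_eq_iff)

lemma omit_omit:
  assumes "i \<le> k" "k \<le> Suc n"
  shows "omit n i (omit (Suc n) (Suc k) x) = omit n k (omit (Suc n) i x)"
  using assms by (auto simp: omit_def fun_eq_iff)

lemma coboundary_coboundary: "coboundary (Suc n) (coboundary n f) = (\<lambda>_. 0)"
proof
  fix x :: "nat \<Rightarrow> 'a"
  define s where "s i k = (-1) ^ (i + k) * f (omit n k (omit (Suc n) i x))" for i k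
  let ?S = "{..Suc (Suc n)} \<times> {..Suc n}"
  let ?A = "{p \<in> ?S. snd p < fst p}" and ?B = "{p \<in> ?S. fst p \<le> snd p}"
  have "(\<Sum>p\<in>?A. s (fst p) (snd p)) = (\<Sum>p\<in>?B. - s (fst p) (snd p))"
  proof (rule sum.reindex_bij_witness[where i = "\<lambda>(i, k). (Suc k, i)" and j = "\<lambda>(i, k). (k, i - 1)"])
    fix p assume p: "p \<in> ?A"
    then obtain i k where ik: "p = (Suc i, k)" "k \<le> i" "i \<le> Suc n"
      by (cases p; cases "fst p") auto
    then show "- s (fst ((\<lambda>(i, k). (k, i - 1)) p)) (snd ((\<lambda>(i, k). (k, i - 1)) p)) = s (fst p) (snd p)"
      using omit_omit[of k i n x] by (simp add: s_def add.commute)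
  qed auto
  moreover have "?S = ?A \<union> ?B" "?A \<inter> ?B = {}" "finite ?A" "finite ?B"
    by (auto simp: not_less)
  then have "(\<Sum>p\<in>?S. s (fst p) (snd p)) =
      (\<Sum>p\<in>?A. s (fst p) (snd p)) + (\<Sum>p\<in>?B. s (fst p) (snd p))"
    by (metis (no_types, lifting) sum.union_disjoint)
  ultimately have "(\<Sum>p\<in>?S. s (fst p) (snd p)) = 0"
    by (simp add: sum_negf)
  then have "(\<Sum>i\<le>Suc (Suc n). \<Sum>k\<le>Suc n. s i k) = 0"
    by (simp add: sum.cartesian_product split_def del: sum.atMost_Suc)
  then show "coboundary (Suc n) (coboundary n f) x = 0"
    by (simp add: coboundary_def s_def sum_distrib_left power_add mult.assoc del: sum.atMost_Suc)
qed

lemma coboundary_zero [simp]: "coboundary n (\<lambda>_. 0) = (\<lambda>_. 0)"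
  by (simp add: coboundary_def fun_eq_iff)

lemma coboundary_add:
  "coboundary n (\<lambda>x. f x + h x) = (\<lambda>x. coboundary n f x + coboundary n h x)"
  by (auto simp: coboundary_def fun_eq_iff sum.distrib algebra_simps simp del: sum.atMost_Suc)

lemma coboundary_minus: "coboundary n (\<lambda>x. - f x) = (\<lambda>x. - coboundary n f x)"
  by (auto simp: coboundary_def fun_eq_iff sum_negf simp del: sum.atMost_Suc)

lemma bounded_cochains_zero [simp]: "(\<lambda>_. 0) \<in> bounded_cochains T n"
  by (simp add: bounded_cochains_def image_constant_conv)

lemma bounded_cochains_add:
  "f \<in> bounded_cochains T n \<Longrightarrow> h \<in> bounded_cochains T n \<Longrightarrow> (\<lambda>x. f x + h x) \<in> bounded_cochains T n"
  by (auto simp: bounded_cochains_def intro!: continuous_map_add bounded_plus_comp)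

lemma bounded_cochains_minus:
  "f \<in> bounded_cochains T n \<Longrightarrow> (\<lambda>x. - f x) \<in> bounded_cochains T n"
  by (auto simp: bounded_cochains_def intro!: continuous_map_minus simp: bounded_iff)

lemma continuous_map_omit:
  assumes "i \<le> Suc n"
  shows "continuous_map (product_topology (\<lambda>_. T) {..Suc n}) (product_topology (\<lambda>_. T) {..n}) (omit n i)"
  unfolding continuous_map_componentwise using assms
  by (auto simp: omit_def intro!: continuous_map_product_projection)

lemma coboundary_in_bounded_cochains:
  assumes T: "topspace T = UNIV" and f: "f \<in> bounded_cochains T n"
  shows "coboundary n f \<in> bounded_cochains T (Suc n)"
proof -
  let ?P = "product_topology (\<lambda>_. T) {..Suc n}"
  have "continuous_map ?P euclideanreal (\<lambda>x. \<Sum>i\<le>Suc n. (-1) ^ i * f (omit n i x))"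
  proof (rule continuous_map_sum)
    fix i assume "i \<in> {..Suc n}"
    then have "continuous_map ?P euclideanreal (f \<circ> omit n i)"
      using f by (intro continuous_map_compose[OF continuous_map_omit])
        (simp_all add: bounded_cochains_def)
    then show "continuous_map ?P euclideanreal (\<lambda>x. (-1) ^ i * f (omit n i x))"
      by (intro continuous_map_real_mult) (simp_all add: o_def)
  qed simp
  then have 1: "continuous_map ?P euclideanreal (coboundary n f)"
    by (rule continuous_map_eq) (simp add: coboundary_def tuples_def T)
  obtain b where b: "\<And>x. \<bar>f x\<bar> \<le> b"
    using f by (auto simp: bounded_cochains_def bounded_iff)
  have "\<bar>coboundary n f x\<bar> \<le> (\<Sum>i\<le>Suc n. b)" for x
  proof -
    have "\<bar>\<Sum>i\<le>Suc n. (-1) ^ i * f (omit n i x)\<bar> \<le> (\<Sum>i\<le>Suc n. b)"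
      by (rule order.trans[OF sum_abs], rule sum_mono) (simp add: abs_mult b)
    moreover have "0 \<le> b"
      using b[of x] by simp
    ultimately show ?thesis
      by (simp add: coboundary_def del: sum.atMost_Suc)
  qed
  then have 2: "bounded (range (coboundary n f))"
    by (auto simp: bounded_iff)
  have 3: "coboundary n f (\<lambda>j\<in>{..Suc n}. g + x j) = coboundary n f x" if "x \<in> tuples (Suc n)" for g x
  proof -
    have "(\<lambda>j\<in>{..Suc n}. g + x j) \<in> tuples (Suc n)"
      by (simp add: tuples_def)
    moreover have "f (omit n i (\<lambda>j\<in>{..Suc n}. g + x j)) = f (omit n i x)" if "i \<le> Suc n" for i
    proof -
      have "f (\<lambda>j\<in>{..n}. g + omit n i x j) = f (omit n i x)"
        using f omit_in_tuples unfolding bounded_cochains_def by blast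
      with that show ?thesis
        by (simp only: omit_translate)
    qed
    ultimately show ?thesis
      using that unfolding coboundary_def by (simp only: if_True) (rule sum.cong, simp_all)
  qed
  show ?thesis
    unfolding bounded_cochains_def
  proof (intro CollectI conjI allI ballI impI)
    show "coboundary n f x = 0" if "x \<notin> tuples (Suc n)" for x
      using that by (simp add: coboundary_def)
  qed (fact 1 2 3)+
qed

lemma comm_group_cocycle_group: "comm_group (cocycle_group T n)"
proof (rule comm_groupI)
  fix f assume f: "f \<in> carrier (cocycle_group T n)"
  show "\<exists>h\<in>carrier (cocycle_group T n). h \<otimes>\<^bsub>cocycle_group T n\<^esub> f = \<one>\<^bsub>cocycle_group T n\<^esub>"
    using f by (intro bexI[of _ "\<lambda>x. - f x"])
      (auto simp: cocycle_group_def bounded_cocycles_def bounded_cochains_minus coboundary_minus)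
qed (auto simp: cocycle_group_def bounded_cocycles_def bounded_cochains_add coboundary_add)

lemma inv_cocycle_group:
  assumes "f \<in> bounded_cocycles T n"
  shows "inv\<^bsub>cocycle_group T n\<^esub> f = (\<lambda>x. - f x)"
proof -
  interpret comm_group "cocycle_group T n" by (rule comm_group_cocycle_group)
  show ?thesis
    using assms by (intro inv_equality)
      (auto simp: cocycle_group_def bounded_cocycles_def bounded_cochains_minus coboundary_minus)
qed

lemma bounded_coboundaries_subset_cocycles:
  "topspace T = UNIV \<Longrightarrow> bounded_coboundaries T n \<subseteq> bounded_cocycles T n"
  by (auto simp: bounded_coboundaries_def bounded_cocycles_def coboundary_coboundary
      coboundary_in_bounded_cochains split: nat.split)

lemma bounded_coboundaries_minus:
  assumes "f \<in> bounded_coboundaries T n"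
  shows "(\<lambda>x. - f x) \<in> bounded_coboundaries T n"
proof (cases n)
  case (Suc m)
  then obtain u where u: "u \<in> bounded_cochains T m" "f = coboundary m u"
    using assms by (auto simp: bounded_coboundaries_def)
  then have "(\<lambda>x. - f x) = coboundary m (\<lambda>x. - u x)"
    by (simp only: coboundary_minus)
  moreover have "(\<lambda>x. - u x) \<in> bounded_cochains T m"
    using u(1) by (rule bounded_cochains_minus)
  ultimately show ?thesis
    unfolding Suc bounded_coboundaries_def nat.case by (rule image_eqI)
qed (use assms in \<open>simp add: bounded_coboundaries_def\<close>)

lemma bounded_coboundaries_add:
  assumes "f \<in> bounded_coboundaries T n" "h \<in> bounded_coboundaries T n"
  shows "(\<lambda>x. f x + h x) \<in> bounded_coboundaries T n"
proof (cases n)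
  case (Suc m)
  then obtain u v where uv: "u \<in> bounded_cochains T m" "f = coboundary m u"
      "v \<in> bounded_cochains T m" "h = coboundary m v"
    using assms by (auto simp: bounded_coboundaries_def)
  then have "(\<lambda>x. f x + h x) = coboundary m (\<lambda>x. u x + v x)"
    by (simp only: coboundary_add)
  moreover have "(\<lambda>x. u x + v x) \<in> bounded_cochains T m"
    using uv(1,3) by (rule bounded_cochains_add)
  ultimately show ?thesis
    unfolding Suc bounded_coboundaries_def nat.case by (rule image_eqI)
qed (use assms in \<open>simp add: bounded_coboundaries_def\<close>)

lemma bounded_coboundaries_normal:
  assumes T: "topspace T = UNIV"
  shows "bounded_coboundaries T n \<lhd> cocycle_group T n"
proof -
  interpret comm_group "cocycle_group T n" by (rule comm_group_cocycle_group)
  have "subgroup (bounded_coboundaries T n) (cocycle_group T n)"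
  proof (rule subgroupI)
    show "bounded_coboundaries T n \<subseteq> carrier (cocycle_group T n)"
      using bounded_coboundaries_subset_cocycles[OF T] by (simp add: cocycle_group_def)
    show "bounded_coboundaries T n \<noteq> {}"
      by (auto simp: bounded_coboundaries_def split: nat.split intro: bounded_cochains_zero)
  next
    fix f assume f: "f \<in> bounded_coboundaries T n"
    then have "f \<in> bounded_cocycles T n"
      using bounded_coboundaries_subset_cocycles[OF T] by blast
    moreover have "(\<lambda>x. - f x) \<in> bounded_coboundaries T n"
      using f by (rule bounded_coboundaries_minus)
    ultimately show "inv\<^bsub>cocycle_group T n\<^esub> f \<in> bounded_coboundaries T n"
      by (simp add: inv_cocycle_group)
  next
    fix f h assume "f \<in> bounded_coboundaries T n" "h \<in> bounded_coboundaries T n"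
    then show "f \<otimes>\<^bsub>cocycle_group T n\<^esub> h \<in> bounded_coboundaries T n"
      by (simp add: cocycle_group_def bounded_coboundaries_add)
  qed
  then show ?thesis
    by (rule subgroup_imp_normal)
qed

lemma comm_group_cb_cohomology: "topspace T = UNIV \<Longrightarrow> comm_group (cb_cohomology T n)"
  unfolding cb_cohomology_def
  by (intro comm_group.abelian_FactGroup comm_group_cocycle_group
      normal_imp_subgroup bounded_coboundaries_normal)

lemma discretization_class:
  assumes T: "topspace T = UNIV" and f: "f \<in> bounded_cocycles T n"
  shows "discretization n (bounded_coboundaries T n #>\<^bsub>cocycle_group T n\<^esub> f) =
         bounded_coboundaries (discrete_topology UNIV) n
           #>\<^bsub>cocycle_group (discrete_topology UNIV) n\<^esub> f"
proof -
  let ?D = "cocycle_group (discrete_topology UNIV :: 'a topology) n"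
  let ?B = "bounded_coboundaries (discrete_topology UNIV :: 'a topology) n"
  interpret comm_group ?D by (rule comm_group_cocycle_group)
  have B: "subgroup ?B ?D"
    by (intro normal_imp_subgroup bounded_coboundaries_normal) simp
  have fD: "f \<in> carrier ?D"
    using f bounded_cocycles_subset_discrete by (auto simp: cocycle_group_def)
  have "?B #>\<^bsub>?D\<^esub> h = ?B #>\<^bsub>?D\<^esub> f" if "h \<in> bounded_coboundaries T n #>\<^bsub>cocycle_group T n\<^esub> f" for h
  proof -
    have "h \<in> ?B #>\<^bsub>?D\<^esub> f"
      using that bounded_coboundaries_subset_discrete[of T n]
      by (auto simp: r_coset_def cocycle_group_def)
    then show ?thesis
      using repr_independence[OF _ fD B] by simp
  qed
  moreover have "f \<in> bounded_coboundaries T n #>\<^bsub>cocycle_group T n\<^esub> f"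
    using f T comm_group_cocycle_group[of T n]
    by (intro group.rcos_self normal_imp_subgroup bounded_coboundaries_normal)
      (auto simp: comm_group_def cocycle_group_def)
  ultimately show ?thesis
    unfolding discretization_def by blast
qed

end

theory Submission
  imports Defs "HOL-Probability.Product_PMF"
begin

text \<open>
  Put \<open>P x = {p. act (- p) x \<in> Y}\<close>, so that \<open>P (act h x) = h + P x\<close>. Differences of points of \<open>P x\<close> are
  return times. As 0 is isolated among the return times, the sets \<open>P x\<close> are uniformly separated, and
  there is a continuous weight \<open>\<phi> > 0\<close> whose sum over all translates of all \<open>P x\<close> converges. Choosing
  \<open>p \<in> P x\<close> with probability proportional to \<open>\<phi> (- p + g)\<close> therefore gives an equivariant random point
  that depends continuously on \<open>g\<close> in total variation.

  Let \<open>f\<close> be a continuous bounded cocycle with \<open>f = du\<close> for a bounded cochain \<open>u\<close> of the discrete group.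
  Replace the entries of a tuple \<open>g\<close> by independent random points \<open>\<kappa>\<close> of \<open>P x\<close>, and average
  \<open>u \<kappa> - D f g \<kappa>\<close> over \<open>\<kappa>\<close> and \<open>x\<close>, where \<open>D\<close> is the prism operator between the identity and the
  replacement. The result is a continuous bounded primitive of \<open>f\<close>: continuity comes from the random
  choice although \<open>u\<close> is arbitrary, and \<open>u\<close> may be integrated because it is evaluated only on tuples
  whose differences lie in the countable set of return times.
\<close>

section \<open>The prism operator\<close>

text \<open>The vertices (g_0, ..., g_i, k_i, ..., k_m) of the \<open>i\<close>-th simplex in the
  usual triangulation of the prism with bottom \<open>g\<close> and top \<open>k\<close>. The entry
  \<open>k i\<close> sits at position \<open>Suc i\<close>, hence the shift
  \<open>j - 1\<close>.\<close>

definition join :: "nat \<Rightarrow> nat \<Rightarrow> (nat \<Rightarrow> 'g) \<Rightarrow> (nat \<Rightarrow> 'g) \<Rightarrow> nat \<Rightarrow> 'g" where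
  "join m i g k = (\<lambda>j\<in>{..Suc m}. if j \<le> i then g j else k (j - 1))"

definition prism :: "nat \<Rightarrow> ((nat \<Rightarrow> 'g) \<Rightarrow> real) \<Rightarrow> (nat \<Rightarrow> 'g) \<Rightarrow> (nat \<Rightarrow> 'g) \<Rightarrow> real" where
  "prism m f g k = (\<Sum>i\<le>m. (-1) ^ i * f (join m i g k))"

lemma join_in_tuples [simp]: "join m i g k \<in> tuples (Suc m)"
  by (simp add: join_def tuples_def)

text \<open>Together with the next four lemmas this lists the faces of the simplices of the prism: a
  face may lie in the prism over a face of the base (two cases, as a vertex of \<open>g\<close> or
  of \<open>k\<close> is dropped), be shared by consecutive simplices, or be the top or the
  bottom.\<close>

lemma omit_join_less:
  assumes "l \<le> i" "i \<le> m"
  shows "omit (Suc m) l (join (Suc m) (Suc i) g k) = join m i (omit m l g) (omit m l k)"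
  using assms by (auto simp: omit_def join_def fun_eq_iff Suc_diff_le)

lemma omit_join_greater:
  assumes "i < l" "l \<le> Suc m"
  shows "omit (Suc m) (Suc l) (join (Suc m) i g k) = join m i (omit m l g) (omit m l k)"
  using assms by (auto simp: omit_def join_def fun_eq_iff)

lemma omit_join_diag:
  assumes "i \<le> m"
  shows "omit (Suc m) (Suc i) (join (Suc m) i g k) = omit (Suc m) (Suc i) (join (Suc m) (Suc i) g k)"
  using assms by (auto simp: omit_def join_def fun_eq_iff le_Suc_eq)

lemma omit_join_0:
  assumes "k \<in> tuples (Suc m)"
  shows "omit (Suc m) 0 (join (Suc m) 0 g k) = k"
  using assms by (auto simp: omit_def join_def fun_eq_iff tuples_def PiE_def extensional_def)

lemma omit_join_last:
  assumes "g \<in> tuples (Suc m)"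
  shows "omit (Suc m) (Suc (Suc m)) (join (Suc m) (Suc m) g k) = g"
  using assms by (auto simp: omit_def join_def fun_eq_iff tuples_def PiE_def extensional_def)

text \<open>The cocycle relation holds on each simplex of the prism. In the alternating sum of these
  relations the shared faces cancel, top and bottom contribute \<open>f k - f g\<close>, and the
  remaining faces assemble to the prism operator on the faces of the base.\<close>

lemma prism_homotopy:
  assumes f: "coboundary (Suc m) f = (\<lambda>_. 0)" and g: "g \<in> tuples (Suc m)" and k: "k \<in> tuples (Suc m)"
  shows "(\<Sum>l\<le>Suc m. (-1) ^ l * prism m f (omit m l g) (omit m l k)) = f k - f g"
proof -
  define F where "F l i = f (omit (Suc m) l (join (Suc m) i g k))" for l i
  define Q where "Q l i = (-1) ^ (l + i) * f (join m i (omit m l g) (omit m l k))" for l i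
  have cancel: "(\<Sum>l\<le>Suc (Suc m). (-1) ^ l * F l i) = 0" for i
    using fun_cong[OF f, of "join (Suc m) i g k"]
    by (simp add: coboundary_def F_def del: sum.atMost_Suc)
  \<comment> \<open>Dropping \<open>g i\<close> or \<open>k i\<close> from the \<open>i\<close>-th
    simplex leaves a face over the full base; these two terms are isolated. Smaller \<open>l\<close>
    drop other entries of \<open>g\<close>, larger ones drop entries of \<open>k\<close>.\<close>
  have split: "(\<Sum>l\<le>Suc (Suc m). (-1) ^ (i + l) * F l i) =
      F i i - F (Suc i) i + (\<Sum>l<i. (-1) ^ (i + l) * F l i) + (\<Sum>l\<in>{Suc i<..Suc (Suc m)}. (-1) ^ (i + l) * F l i)"
    if "i \<le> Suc m" for i
  proof -
    have "{..Suc (Suc m)} = insert i (insert (Suc i) ({..<i} \<union> {Suc i<..Suc (Suc m)}))"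
      using that by auto
    then have "(\<Sum>l\<le>Suc (Suc m). (-1) ^ (i + l) * F l i) =
      (\<Sum>l\<in>insert i (insert (Suc i) ({..<i} \<union> {Suc i<..Suc (Suc m)})). (-1) ^ (i + l) * F l i)"
      by simp
    also have "\<dots> = F i i - F (Suc i) i + ((\<Sum>l<i. (-1) ^ (i + l) * F l i) + (\<Sum>l\<in>{Suc i<..Suc (Suc m)}. (-1) ^ (i + l) * F l i))"
      by (subst sum.insert; simp?)+ (subst sum.union_disjoint; force simp: mult_2[symmetric])
    finally show ?thesis by simp
  qed
  \<comment> \<open>The inner sum is empty for \<open>i = 0\<close>, so \<open>i\<close> is shifted
    by one; the shift causes the change of sign.\<close>
  have low: "(\<Sum>i\<le>Suc m. \<Sum>l<i. (-1) ^ (i + l) * F l i) = - (\<Sum>i\<le>m. \<Sum>l\<le>i. Q l i)"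
  proof -
    have "(\<Sum>i\<le>Suc m. \<Sum>l<i. (-1) ^ (i + l) * F l i) = (\<Sum>i\<le>m. \<Sum>l<Suc i. (-1) ^ (Suc i + l) * F l (Suc i))"
      by (subst sum.atMost_Suc_shift) simp
    also have "\<dots> = (\<Sum>i\<le>m. - (\<Sum>l\<le>i. Q l i))"
      by (intro sum.cong refl) (auto simp: lessThan_Suc_atMost sum_negf[symmetric] F_def Q_def omit_join_less add.commute
          simp del: sum.lessThan_Suc intro!: sum.cong)
    finally show ?thesis by (simp add: sum_negf)
  qed
  have high: "(\<Sum>i\<le>Suc m. \<Sum>l\<in>{Suc i<..Suc (Suc m)}. (-1) ^ (i + l) * F l i) = - (\<Sum>i\<le>m. \<Sum>l\<in>{i<..Suc m}. Q l i)"
  proof -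
    have "(\<Sum>l\<in>{Suc i<..Suc (Suc m)}. (-1) ^ (i + l) * F l i) = - (\<Sum>l\<in>{i<..Suc m}. Q l i)" for i
    proof -
      have "(\<Sum>l\<in>{Suc i<..Suc (Suc m)}. (-1) ^ (i + l) * F l i) = (\<Sum>l\<in>{i<..Suc m}. (-1) ^ (i + Suc l) * F (Suc l) i)"
        by (rule sum.reindex_bij_witness[of _ Suc "\<lambda>l. l - 1"]) auto
      also have "\<dots> = (\<Sum>l\<in>{i<..Suc m}. - Q l i)"
        by (intro sum.cong refl) (auto simp: F_def Q_def omit_join_greater add.commute)
      finally show ?thesis by (simp add: sum_negf)
    qed
    then show ?thesis by (simp add: sum_negf)
  qed
  \<comment> \<open>By \<open>omit_join_diag\<close>,
    \<open>F (Suc i) i = F (Suc i) (Suc i)\<close>, so the sum telescopes.\<close>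
  have diag: "(\<Sum>i\<le>Suc m. F i i - F (Suc i) i) = f k - f g"
  proof -
    have "(\<Sum>i\<le>n. F i i - F (Suc i) i) = F 0 0 - F (Suc n) n" if "n \<le> Suc m" for n
      using that by (induction n) (auto simp: F_def omit_join_diag)
    then show ?thesis
      by (simp add: F_def omit_join_0 omit_join_last g k del: sum.atMost_Suc)
  qed
  \<comment> \<open>The sum from \<open>low\<close> covers the pairs with \<open>l \<le> i\<close>,
    that from \<open>high\<close> the pairs with \<open>i < l\<close>.\<close>
  have QQ: "(\<Sum>i\<le>m. \<Sum>l\<le>i. Q l i) + (\<Sum>i\<le>m. \<Sum>l\<in>{i<..Suc m}. Q l i) = (\<Sum>i\<le>m. \<Sum>l\<le>Suc m. Q l i)"
  proof -
    have "(\<Sum>l\<le>i. Q l i) + (\<Sum>l\<in>{i<..Suc m}. Q l i) = (\<Sum>l\<le>Suc m. Q l i)" if "i \<le> m" for i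
    proof -
      have "{..Suc m} = {..i} \<union> {i<..Suc m}" using that by auto
      then show ?thesis by (simp only:) (subst sum.union_disjoint, auto)
    qed
    then show ?thesis by (simp add: sum.distrib[symmetric] del: sum.atMost_Suc)
  qed
  have "0 = (\<Sum>i\<le>Suc m. (-1) ^ i * (\<Sum>l\<le>Suc (Suc m). (-1) ^ l * F l i))"
    by (simp only: cancel) simp
  also have "\<dots> = (\<Sum>i\<le>Suc m. \<Sum>l\<le>Suc (Suc m). (-1) ^ (i + l) * F l i)"
    by (simp only: sum_distrib_left power_add mult.assoc)
  also have "\<dots> = (\<Sum>i\<le>Suc m. F i i - F (Suc i) i + (\<Sum>l<i. (-1) ^ (i + l) * F l i) + (\<Sum>l\<in>{Suc i<..Suc (Suc m)}. (-1) ^ (i + l) * F l i))"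
    by (intro sum.cong refl split) simp
  also have "\<dots> = f k - f g - (\<Sum>i\<le>m. \<Sum>l\<le>Suc m. Q l i)"
    by (simp only: sum.distrib low high diag QQ[symmetric])
  finally have "(\<Sum>i\<le>m. \<Sum>l\<le>Suc m. Q l i) = f k - f g" by simp
  then have "(\<Sum>l\<le>Suc m. \<Sum>i\<le>m. Q l i) = f k - f g" by (subst sum.swap)
  then show ?thesis
    by (simp only: prism_def Q_def sum_distrib_left power_add mult.assoc)
qed

lemma join_translate:
  assumes "i \<le> m"
  shows "join m i (\<lambda>j\<in>{..m}. h + g j) (\<lambda>j\<in>{..m}. h + k j) = (\<lambda>j\<in>{..Suc m}. h + join m i g k j)"
  using assms by (auto simp: join_def fun_eq_iff)

section \<open>Reduction of injectivity to cocycles\<close>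

text \<open>Representatives of two classes with equal image differ by a coboundary \<open>c\<close>
  of the discrete group. As a difference of continuous cocycles, \<open>c\<close> is itself one, so
  a trivial kernel on the level of cocycles suffices.\<close>

lemma inj_on_discretization:
  assumes T: "topspace T = UNIV"
    and *: "\<And>f. f \<in> bounded_cocycles T n \<Longrightarrow> f \<in> bounded_coboundaries (discrete_topology UNIV) n \<Longrightarrow>
      f \<in> bounded_coboundaries T n"
  shows "inj_on (discretization n) (carrier (cb_cohomology T n))"
proof (rule inj_onI)
  let ?C = "cocycle_group T n" and ?D = "cocycle_group (discrete_topology UNIV :: 'a topology) n"
  let ?B = "bounded_coboundaries T n" and ?B' = "bounded_coboundaries (discrete_topology UNIV :: 'a topology) n"
  interpret C: comm_group ?C by (rule comm_group_cocycle_group)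
  interpret D: comm_group ?D by (rule comm_group_cocycle_group)
  have B: "subgroup ?B ?C" and B': "subgroup ?B' ?D"
    using T by (auto intro!: normal_imp_subgroup bounded_coboundaries_normal)
  fix X X' assume X: "X \<in> carrier (cb_cohomology T n)" "X' \<in> carrier (cb_cohomology T n)"
    and eq: "discretization n X = discretization n X'"
  obtain f f' where f: "f \<in> bounded_cocycles T n" "X = ?B #>\<^bsub>?C\<^esub> f"
      "f' \<in> bounded_cocycles T n" "X' = ?B #>\<^bsub>?C\<^esub> f'"
    using X by (auto simp: cb_cohomology_def FactGroup_def RCOSETS_def cocycle_group_def)
  then have "?B' #>\<^bsub>?D\<^esub> f = ?B' #>\<^bsub>?D\<^esub> f'"
    using eq by (simp add: discretization_class T)
  moreover have "f \<in> carrier ?D" "f' \<in> carrier ?D"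
    using f bounded_cocycles_subset_discrete by (auto simp: cocycle_group_def)
  then have "f \<in> ?B' #>\<^bsub>?D\<^esub> f"
    using B' by (intro D.rcos_self)
  ultimately obtain c where c: "c \<in> ?B'" "f = (\<lambda>z. c z + f' z)"
    by (auto simp: r_coset_def cocycle_group_def)
  then have c_eq: "c = (\<lambda>z. f z + - f' z)"
    by (simp add: fun_eq_iff)
  have "(\<lambda>z. - f' z) \<in> bounded_cocycles T n"
    using f(3) by (auto simp: bounded_cocycles_def bounded_cochains_minus coboundary_minus)
  then have "c \<in> bounded_cocycles T n"
    unfolding c_eq using f(1) bounded_cochains_add[of f T n "\<lambda>z. - f' z"] coboundary_add[of n f "\<lambda>z. - f' z"]
    by (simp add: bounded_cocycles_def)
  then have "c \<in> ?B"
    using c(1) by (rule *)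
  then have "f \<in> ?B #>\<^bsub>?C\<^esub> f'"
    unfolding c(2) by (auto simp: r_coset_def cocycle_group_def)
  then show "X = X'"
    using C.repr_independence[OF _ _ B, of f f'] f by (simp add: cocycle_group_def)
qed

section \<open>Products of discrete distributions\<close>

text \<open>Selecting coordinates along an injection and transforming each of them preserves
  independence. With \<open>s\<close> the identity this gives equivariance of the samples, with
  \<open>h\<close> the identity their compatibility with faces. The default \<open>undefined\<close>
  matches extensional tuples.\<close>

lemma map_Pi_pmf_reindex:
  assumes A: "finite A" and s: "inj_on s B" "s ` B \<subseteq> A"
  shows "map_pmf (\<lambda>k. \<lambda>j\<in>B. h (k (s j))) (Pi_pmf A d p) = Pi_pmf B undefined (\<lambda>j. map_pmf h (p (s j)))"
proof (rule pmf_eqI)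
  fix f
  have B: "finite B"
    using A s finite_imageD finite_subset by blast
  let ?r = "\<lambda>k. \<lambda>j\<in>B. h (k (s j))"
  show "pmf (map_pmf ?r (Pi_pmf A d p)) f = pmf (Pi_pmf B undefined (\<lambda>j. map_pmf h (p (s j)))) f"
  proof (cases "f \<in> extensional B")
    case True
    \<comment> \<open>Coordinates outside the image of \<open>s\<close> are unconstrained, so their
      factors in the product of probabilities are 1.\<close>
    define C where "C i = (if i \<in> s ` B then h -` {f (the_inv_into B s i)} else UNIV)" for i
    have "?r -` {f} = Pi A C"
    proof (intro Set.set_eqI iffI)
      fix k assume k: "k \<in> ?r -` {f}"
      show "k \<in> Pi A C"
      proof
        fix i assume "i \<in> A"
        show "k i \<in> C i"
        proof (cases "i \<in> s ` B")
          case True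
          then obtain j where "j \<in> B" "i = s j" by blast
          with k s show ?thesis by (auto simp: C_def the_inv_into_f_f)
        qed (simp add: C_def)
      qed
    next
      fix k assume "k \<in> Pi A C"
      then have "h (k (s j)) = f j" if "j \<in> B" for j
        using that s by (force simp: C_def the_inv_into_f_f Pi_iff)
      then have "?r k = f"
        using True by (auto simp: fun_eq_iff extensional_def)
      then show "k \<in> ?r -` {f}" by simp
    qed
    then have "pmf (map_pmf ?r (Pi_pmf A d p)) f = (\<Prod>i\<in>A. measure_pmf.prob (p i) (C i))"
      using A by (simp add: pmf_map measure_Pi_pmf_Pi)
    also have "\<dots> = (\<Prod>i\<in>s ` B. measure_pmf.prob (p i) (C i))"
      using A s by (intro prod.mono_neutral_right) (auto simp: C_def)
    also have "\<dots> = (\<Prod>j\<in>B. pmf (map_pmf h (p (s j))) (f j))"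
      using s by (subst prod.reindex) (auto simp: C_def the_inv_into_f_f pmf_map intro!: prod.cong)
    finally show ?thesis
      using True B by (simp add: pmf_Pi extensional_def)
  next
    case False
    then have "?r -` {f} = {}" by (auto simp: extensional_def)
    then show ?thesis
      using False B by (auto simp add: pmf_map pmf_Pi extensional_def)
  qed
qed

lemma integrable_pmf_bounded:
  fixes H :: "'a \<Rightarrow> real"
  assumes "\<And>z. \<bar>H z\<bar> \<le> C"
  shows "integrable (measure_pmf Q) H"
  by (rule measure_pmf.integrable_const_bound[where B = C]) (use assms in auto)

lemma expectation_pmf_bounded:
  fixes H :: "'a \<Rightarrow> real"
  assumes "\<And>z. \<bar>H z\<bar> \<le> C"
  shows "\<bar>measure_pmf.expectation Q H\<bar> \<le> C"
proof -
  have "\<bar>measure_pmf.expectation Q H\<bar> \<le> measure_pmf.expectation Q (\<lambda>z. \<bar>H z\<bar>)"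
    by (rule integral_abs_bound)
  also have "\<dots> \<le> measure_pmf.expectation Q (\<lambda>_. C)"
    using assms by (intro integral_mono integrable_pmf_bounded[where C = C] integrable_pmf_bounded[where C = "\<bar>C\<bar>"]) auto
  finally show ?thesis by simp
qed

lemma expectation_pmf_count_space:
  fixes H :: "'a \<Rightarrow> real"
  shows "measure_pmf.expectation Q H = (\<integral>z. pmf Q z * H z \<partial>count_space UNIV)"
  unfolding measure_pmf_eq_density by (subst integral_density) auto

text \<open>By Scheffe's lemma, pointwise convergence of probability masses to a probability mass
  function is convergence in l1. Hence the integrands need only a uniform bound and pointwise
  convergence, with no regularity in \<open>z\<close>; this is what allows an arbitrary discrete
  cochain later.\<close>

lemma tendsto_expectation_pmf:
  fixes H :: "nat \<Rightarrow> 'a \<Rightarrow> real"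
  assumes Q: "\<And>z. (\<lambda>k. pmf (Q k) z) \<longlonglongrightarrow> pmf P z"
    and H: "\<And>z. (\<lambda>k. H k z) \<longlonglongrightarrow> G z"
    and bnd: "\<And>k z. \<bar>H k z\<bar> \<le> C"
  shows "(\<lambda>k. measure_pmf.expectation (Q k) (H k)) \<longlonglongrightarrow> measure_pmf.expectation P G"
proof -
  let ?N = "count_space (UNIV :: 'a set)"
  have one: "(\<integral>\<^sup>+z. norm (pmf p z) \<partial>?N) = 1" for p :: "'a pmf"
    using nn_integral_pmf[where p = p and A = UNIV] measure_pmf.emeasure_space_1[of p] by simp
  have int: "integrable ?N (pmf p)" for p :: "'a pmf"
    by (rule integrable_pmf)
  have "(\<lambda>k. \<integral>\<^sup>+z. norm (pmf (Q k) z - pmf P z) \<partial>?N) \<longlonglongrightarrow> 0"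
    by (rule Scheffe_lemma2) (use Q int one in auto)
  then have "(\<lambda>k. ennreal (\<integral>z. norm (pmf (Q k) z - pmf P z) \<partial>?N)) \<longlonglongrightarrow> 0"
    by (subst (asm) nn_integral_eq_integral) (auto intro!: int)
  then have 1: "(\<lambda>k. \<integral>z. norm (pmf (Q k) z - pmf P z) \<partial>?N) \<longlonglongrightarrow> 0"
    by (subst (asm) ennreal_0[symmetric], subst (asm) tendsto_ennreal_iff) auto
  have Hint: "integrable ?N (\<lambda>z. pmf p z * H k z)" for p k
  proof (rule Bochner_Integration.integrable_bound[of _ "\<lambda>z. C * pmf p z"])
    have "norm (pmf p z * H k z) \<le> norm (C * pmf p z)" for z
      using mult_right_mono[OF order.trans[OF bnd[of k z] abs_ge_self], of "pmf p z"]
      by (simp add: abs_mult mult.commute)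
    then show "AE z in ?N. norm (pmf p z * H k z) \<le> norm (C * pmf p z)"
      by simp
  qed (use int in auto)
  \<comment> \<open>Under the fixed law \<open>P\<close> dominated convergence applies; replacing
    \<open>P\<close> by \<open>Q k\<close> then costs at most \<open>C\<close> times the l1
    distance.\<close>
  have 2: "(\<lambda>k. measure_pmf.expectation P (H k)) \<longlonglongrightarrow> measure_pmf.expectation P G"
    by (rule integral_dominated_convergence[where w = "\<lambda>_. C"]) (use H bnd in auto)
  have "(\<lambda>k. measure_pmf.expectation (Q k) (H k) - measure_pmf.expectation P (H k)) \<longlonglongrightarrow> 0"
  proof (rule tendsto_rabs_zero_cancel, rule tendsto_sandwich[of "\<lambda>_. 0"])
    show "(\<lambda>k. C * (\<integral>z. norm (pmf (Q k) z - pmf P z) \<partial>?N)) \<longlonglongrightarrow> 0"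
      using tendsto_mult_left[OF 1, of C] by simp
    show "\<forall>\<^sub>F k in sequentially. \<bar>measure_pmf.expectation (Q k) (H k) - measure_pmf.expectation P (H k)\<bar>
        \<le> C * (\<integral>z. norm (pmf (Q k) z - pmf P z) \<partial>?N)"
    proof (intro always_eventually allI)
      fix k
      have "\<bar>measure_pmf.expectation (Q k) (H k) - measure_pmf.expectation P (H k)\<bar> =
          \<bar>\<integral>z. pmf (Q k) z * H k z - pmf P z * H k z \<partial>?N\<bar>"
        by (simp add: expectation_pmf_count_space Hint)
      also have "\<dots> \<le> (\<integral>z. \<bar>pmf (Q k) z * H k z - pmf P z * H k z\<bar> \<partial>?N)"
        by (rule integral_abs_bound)
      also have "\<dots> \<le> (\<integral>z. C * norm (pmf (Q k) z - pmf P z) \<partial>?N)"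
        by (intro integral_mono integrable_abs Bochner_Integration.integrable_diff Hint integrable_mult_right integrable_norm int)
          (simp add: left_diff_distrib[symmetric] abs_mult mult.commute[of C] mult_left_mono bnd)
      finally show "\<bar>measure_pmf.expectation (Q k) (H k) - measure_pmf.expectation P (H k)\<bar>
        \<le> C * (\<integral>z. norm (pmf (Q k) z - pmf P z) \<partial>?N)" by simp
    qed
  qed auto
  from tendsto_add[OF this 2] show ?thesis by simp
qed

section \<open>Summable weights on separated sets\<close>

text \<open>The difference \<open>- p + q\<close> is unchanged when \<open>P\<close> is translated
  from the left, so all left translates of a set are separated by the same \<open>U\<close>.\<close>

definition separated :: "'g::group_add set \<Rightarrow> 'g set \<Rightarrow> bool" where
  "separated U P \<longleftrightarrow> (\<forall>p\<in>P. \<forall>q\<in>P. - p + q \<in> U \<longrightarrow> p = q)"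

text \<open>Take a neighbourhood \<open>V\<close> of 0 whose differences \<open>- v + w\<close> lie
  in \<open>U\<close>, and cover the compact set of inverses of \<open>L\<close> by finitely many
  left translates of \<open>V\<close>. Each translate contains at most one point
  \<open>- g + p\<close>, since \<open>g\<close> and the translation cancel in differences. The size
  of the cover is thus a bound independent of \<open>P\<close> and \<open>g\<close>.\<close>

lemma separated_compact_bound:
  fixes U L :: "'g::topological_group_add set"
  assumes U: "open U" "0 \<in> U" and L: "compact L"
  shows "\<exists>N. \<forall>P g. separated U P \<longrightarrow> finite {p\<in>P. - p + g \<in> L} \<and> card {p\<in>P. - p + g \<in> L} \<le> N"
proof -
  have "open ((\<lambda>x :: 'g \<times> 'g. - fst x + snd x) -` U)"
    by (rule open_vimage) (intro U continuous_intros)+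
  moreover have "(0, 0) \<in> (\<lambda>x :: 'g \<times> 'g. - fst x + snd x) -` U"
    using U by simp
  ultimately obtain A B where AB: "open A" "open B" "(0, 0) \<in> A \<times> B"
      "A \<times> B \<subseteq> (\<lambda>x :: 'g \<times> 'g. - fst x + snd x) -` U"
    by (rule open_prod_elim)
  define V where "V = A \<inter> B"
  have V: "open V" "0 \<in> V" "\<And>v w. v \<in> V \<Longrightarrow> w \<in> V \<Longrightarrow> - v + w \<in> U"
    using AB by (auto simp: V_def)
  have "compact (uminus ` L)"
    by (rule compact_continuous_image[OF _ L]) (intro continuous_intros)
  moreover have "open ((\<lambda>x. - a + x) -` V)" for a
    by (rule open_vimage) (intro V continuous_intros)+
  moreover have "uminus ` L \<subseteq> (\<Union>a\<in>UNIV. (\<lambda>x. - a + x) -` V)"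
  proof
    fix x show "x \<in> (\<Union>a\<in>UNIV. (\<lambda>x. - a + x) -` V)"
      using V(2) by (intro UN_I[of x]) auto
  qed
  ultimately obtain F where F: "finite F" "uminus ` L \<subseteq> (\<Union>a\<in>F. (\<lambda>x. - a + x) -` V)"
    by (rule compactE_image) auto
  have "finite {p\<in>P. - p + g \<in> L} \<and> card {p\<in>P. - p + g \<in> L} \<le> card F" if P: "separated U P" for P g
  proof -
    let ?P = "{p\<in>P. - p + g \<in> L}"
    have "\<exists>a\<in>F. - a + (- g + p) \<in> V" if "p \<in> ?P" for p
    proof -
      have "- (- p + g) \<in> uminus ` L"
        using that by blast
      then show ?thesis
        using F(2) by (auto simp: minus_add)
    qed
    then have "\<forall>p\<in>?P. \<exists>a. a \<in> F \<and> - a + (- g + p) \<in> V"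
      by blast
    from bchoice[OF this] obtain a
      where a: "\<And>p. p \<in> ?P \<Longrightarrow> a p \<in> F" "\<And>p. p \<in> ?P \<Longrightarrow> - a p + (- g + p) \<in> V"
      by blast
    have "inj_on a ?P"
    proof (rule inj_onI)
      fix p q assume pq: "p \<in> ?P" "q \<in> ?P" "a p = a q"
      have "- (- a p + (- g + p)) + (- a p + (- g + q)) \<in> U"
        using V(3)[OF a(2)[OF pq(1)] a(2)[OF pq(2)]] unfolding pq(3) .
      then have "- p + q \<in> U"
        by (simp only: minus_add minus_minus add.assoc minus_add_cancel add_minus_cancel)
      then show "p = q"
        using P pq by (auto simp: separated_def)
    qed
    then show ?thesis
      using a(1) F(1) by (meson card_inj_on_le finite_subset image_subset_iff inj_on_finite)
  qed
  then show ?thesis by blast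
qed

text \<open>Complete regularity of locally compact Hausdorff spaces gives a compactly supported bump
  at every point, and the Lindelof property selects countably many whose positivity sets still
  cover.\<close>

lemma bump_functions:
  assumes lc: "locally_compact_space (euclidean :: 'g::{t2_space, second_countable_topology} topology)"
  obtains \<beta> :: "nat \<Rightarrow> 'g::{t2_space, second_countable_topology} \<Rightarrow> real" and K where
    "\<And>n. compact (K n)" "\<And>n. continuous_on UNIV (\<beta> n)"
    "\<And>n g. 0 \<le> \<beta> n g" "\<And>n g. \<beta> n g \<le> 1" "\<And>n g. g \<notin> K n \<Longrightarrow> \<beta> n g = 0"
    "\<And>g. \<exists>n. 0 < \<beta> n g"
proof -
  let ?good = "\<lambda>f :: 'g \<Rightarrow> real. continuous_on UNIV f \<and> (\<forall>g. 0 \<le> f g \<and> f g \<le> 1) \<and>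
    (\<exists>K. compact K \<and> (\<forall>g. g \<notin> K \<longrightarrow> f g = 0))"
  have Haus: "Hausdorff_space (euclidean :: 'g topology)"
    unfolding Hausdorff_space_def using hausdorff by (auto simp: disjnt_def open_openin[symmetric])
  then have cr: "completely_regular_space (euclidean :: 'g topology)"
    using lc by (intro locally_compact_regular_imp_completely_regular_space) auto
  have ex: "\<exists>f. ?good f \<and> 0 < f x" for x :: 'g
  proof -
    obtain U K where UK: "open U" "compact K" "x \<in> U" "U \<subseteq> K"
      using lc unfolding locally_compact_space_def by simp meson
    have "closedin euclidean (- U)" "x \<in> topspace euclidean - (- U)"
      using UK by auto
    \<comment> \<open>This function is 0 at \<open>x\<close> and 1 outside \<open>U\<close>; the
      bump is \<open>1 - f\<close>.\<close>
    then obtain f where f: "continuous_map euclidean (top_of_set {0..1::real}) f" "f x = 0" "f ` (- U) \<subseteq> {1}"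
      using cr unfolding completely_regular_space_def by blast
    have "continuous_on UNIV f" and f01: "\<And>g. 0 \<le> f g \<and> f g \<le> 1"
      using f(1) by (auto simp: continuous_map_in_subtopology)
    then have "?good (\<lambda>g. 1 - f g)"
      using f(3) UK by (auto intro!: continuous_intros exI[of _ K])
    then show ?thesis
      using f(2) by (intro exI[of _ "\<lambda>g. 1 - f g"]) simp
  qed
  then obtain F where F: "\<And>x. ?good (F x)" "\<And>x :: 'g. 0 < F x x"
    by metis
  let ?\<O> = "range (\<lambda>x. F x -` {0<..})"
  have "open S" if "S \<in> ?\<O>" for S
    using that F(1) by (auto intro!: open_vimage)
  then obtain \<O> where O: "\<O> \<subseteq> ?\<O>" "countable \<O>" "\<Union>\<O> = \<Union>?\<O>"
    by (rule Lindelof)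
  have all: "\<Union>\<O> = UNIV"
    unfolding O(3) using F(2) by fastforce
  then have "\<O> \<noteq> {}" by auto
  then have rng: "range (from_nat_into \<O>) = \<O>"
    using O(2) by (rule range_from_nat_into)
  have "\<exists>x. from_nat_into \<O> n = F x -` {0<..}" for n
  proof -
    have "from_nat_into \<O> n \<in> ?\<O>"
      using rng O(1) by blast
    then show ?thesis by blast
  qed
  then obtain c where c: "\<And>n. from_nat_into \<O> n = F (c n) -` {0<..}"
    by metis
  have "\<exists>K. compact K \<and> (\<forall>g. g \<notin> K \<longrightarrow> F (c n) g = 0)" for n
    using F(1) by blast
  then obtain K where K: "\<And>n. compact (K n)" "\<And>n g. g \<notin> K n \<Longrightarrow> F (c n) g = 0"
    by metis
  have "\<exists>n. 0 < F (c n) g" for g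
  proof -
    have "g \<in> \<Union>(range (from_nat_into \<O>))" using all rng by simp
    then obtain n where "g \<in> from_nat_into \<O> n" by blast
    then show ?thesis
      unfolding c by auto
  qed
  then show ?thesis
    using F(1) K by (intro that[of K "\<lambda>n. F (c n)"]) auto
qed

text \<open>On a neighbourhood with compact hull \<open>W\<close> only finitely many fixed terms can
  be nonzero, so the sum is locally a finite sum of continuous functions.\<close>

lemma continuous_separated_sum:
  fixes \<beta> :: "'g::{topological_group_add, t2_space, second_countable_topology} \<Rightarrow> real"
  assumes lc: "locally_compact_space (euclidean :: 'g topology)"
    and U: "open U" "0 \<in> U" and K: "compact K"
    and \<beta>: "continuous_on UNIV \<beta>" "\<And>g. g \<notin> K \<Longrightarrow> \<beta> g = 0" and P: "separated U P"
  shows "continuous_on UNIV (\<lambda>g. \<integral>p. \<beta> (- p + g) \<partial>count_space P)"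
proof -
  have "\<exists>B. open B \<and> g \<in> B \<and> continuous_on B (\<lambda>g. \<integral>p. \<beta> (- p + g) \<partial>count_space P)" for g
  proof -
    obtain B W where W: "open B" "compact W" "g \<in> B" "B \<subseteq> W"
      using lc unfolding locally_compact_space_def by simp meson
    \<comment> \<open>If \<open>- p + h\<close> is in \<open>K\<close> and \<open>h\<close> is in
      \<open>W\<close>, then \<open>- p\<close> lies in the compact set of differences. The summand
      0 brings this into the shape of \<open>separated_compact_bound\<close>.\<close>
    define F where "F = {p\<in>P. - p + 0 \<in> (\<lambda>x. fst x + - snd x) ` (K \<times> W)}"
    have "compact ((\<lambda>x. fst x + - snd x) ` (K \<times> W))"
      by (intro compact_continuous_image continuous_intros compact_Times K W)
    then have F: "finite F"
      using separated_compact_bound[OF U] P unfolding F_def by blast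
    have "(\<integral>p. \<beta> (- p + h) \<partial>count_space P) = (\<Sum>p\<in>F. \<beta> (- p + h))" if "h \<in> W" for h
    proof -
      have sub: "{p\<in>P. \<beta> (- p + h) \<noteq> 0} \<subseteq> F"
      proof
        fix p assume "p \<in> {p\<in>P. \<beta> (- p + h) \<noteq> 0}"
        then have p: "p \<in> P" "- p + h \<in> K" using \<beta>(2) by auto
        have "- p = fst (- p + h, h) + - snd (- p + h, h)"
          by (simp add: add.assoc)
        then have "- p \<in> (\<lambda>x. fst x + - snd x) ` (K \<times> W)"
          using p that by blast
        then show "p \<in> F"
          using p by (simp add: F_def)
      qed
      then have "(\<integral>p. \<beta> (- p + h) \<partial>count_space P) = (\<Sum>p | p \<in> P \<and> \<beta> (- p + h) \<noteq> 0. \<beta> (- p + h))"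
        using F finite_subset by (intro lebesgue_integral_count_space_finite_support) blast
      also have "\<dots> = (\<Sum>p\<in>F. \<beta> (- p + h))"
        using sub by (intro sum.mono_neutral_left F) (auto simp: F_def)
      finally show ?thesis .
    qed
    note eq = this
    have "continuous_on B (\<lambda>h. \<Sum>p\<in>F. \<beta> (- p + h))"
      by (intro continuous_on_sum continuous_on_compose2[OF \<beta>(1)] continuous_intros) auto
    then have "continuous_on B (\<lambda>g. \<integral>p. \<beta> (- p + g) \<partial>count_space P)"
      by (rule continuous_on_eq) (use eq W in auto)
    then show ?thesis
      using W by blast
  qed
  then show ?thesis
    using continuous_on_eq_continuous_at by (blast intro: continuous_at_imp_continuous_on)
qed

text \<open>The weight is a series of bumps with rapidly decreasing coefficients. The bound of
  \<open>separated_compact_bound\<close> is uniform over separated sets, so one choice of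
  coefficients serves all of them.\<close>

lemma weight_function:
  fixes U :: "'g::{topological_group_add, t2_space, second_countable_topology} set"
  assumes lc: "locally_compact_space (euclidean :: 'g topology)" and U: "open U" "0 \<in> U"
  obtains \<phi> :: "'g \<Rightarrow> real" where "continuous_on UNIV \<phi>" "\<And>g. 0 < \<phi> g"
    "\<And>P g. separated U P \<Longrightarrow> integrable (count_space P) (\<lambda>p. \<phi> (- p + g))"
    "\<And>P. separated U P \<Longrightarrow> continuous_on UNIV (\<lambda>g. \<integral>p. \<phi> (- p + g) \<partial>count_space P)"
proof -
  obtain \<beta> :: "nat \<Rightarrow> 'g \<Rightarrow> real" and K where K: "\<And>n. compact (K n)" and cont: "\<And>n. continuous_on UNIV (\<beta> n)"
    and \<beta>: "\<And>n g. 0 \<le> \<beta> n g" "\<And>n g. \<beta> n g \<le> 1" "\<And>n g. g \<notin> K n \<Longrightarrow> \<beta> n g = 0"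
    and pos: "\<And>g. \<exists>n. 0 < \<beta> n g"
    by (rule bump_functions[OF lc]) (rule that, assumption+)
  have "\<forall>n. \<exists>N. \<forall>P g. separated U P \<longrightarrow> finite {p\<in>P. - p + g \<in> K n} \<and> card {p\<in>P. - p + g \<in> K n} \<le> N"
    using separated_compact_bound[OF U K] by blast
  from choice[OF this] obtain N where N: "\<And>n P g. separated U P \<Longrightarrow> finite {p\<in>P. - p + g \<in> K n} \<and> card {p\<in>P. - p + g \<in> K n} \<le> N n"
    by blast
  \<comment> \<open>At most \<open>N n\<close> points of \<open>P\<close> see the
    \<open>n\<close>-th bump. Dividing by \<open>N n + 1\<close> makes both the series for
    \<open>\<phi>\<close> and the series of its sums over \<open>P\<close> dominated by a geometric
    series, so the Weierstrass test gives continuity of both.\<close>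
  define c where "c n = (1 / 2) ^ n / (real (N n) + 1)" for n
  have c: "0 < c n" "c n \<le> (1 / 2) ^ n" "c n * real (N n) \<le> (1 / 2) ^ n" for n
  proof -
    show "0 < c n"
      unfolding c_def by (intro divide_pos_pos zero_less_power add_nonneg_pos) auto
    have "(1 / 2) ^ n / (real (N n) + 1) \<le> (1 / 2 :: real) ^ n / 1"
      by (intro divide_left_mono) auto
    then show "c n \<le> (1 / 2) ^ n"
      by (simp add: c_def)
    have "c n * real (N n) \<le> c n * (real (N n) + 1)"
      using \<open>0 < c n\<close> by (intro mult_left_mono) auto
    then show "c n * real (N n) \<le> (1 / 2) ^ n"
      by (simp add: c_def)
  qed
  have geo: "summable (\<lambda>n. (1 / 2 :: real) ^ n)"
    by (rule summable_geometric) simp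
  define \<phi> where "\<phi> g = (\<Sum>n. c n * \<beta> n g)" for g
  have bnd: "norm (c n * \<beta> n g) \<le> (1 / 2) ^ n" for n g
    using mult_mono[OF c(2)[of n] \<beta>(2)[of n g]] c(1)[of n] \<beta>(1)[of n g]
    by (simp add: abs_mult)
  have summ: "summable (\<lambda>n. c n * \<beta> n g)" for g
    by (rule summable_comparison_test'[OF geo]) (rule bnd)
  have "continuous_on UNIV \<phi>"
    unfolding \<phi>_def
    by (rule uniform_limit_theorem[OF _ Weierstrass_m_test[OF bnd geo]])
      (auto intro!: always_eventually continuous_intros cont)
  moreover have "0 < \<phi> g" for g
  proof -
    obtain n where "0 < \<beta> n g" using pos by blast
    then show ?thesis
      unfolding \<phi>_def using c(1) \<beta>(1) by (intro suminf_pos2[OF summ, of _ n]) (auto simp: less_imp_le)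
  qed
  moreover have "(\<forall>g. integrable (count_space P) (\<lambda>p. \<phi> (- p + g))) \<and>
       continuous_on UNIV (\<lambda>g. \<integral>p. \<phi> (- p + g) \<partial>count_space P)" if P: "separated U P" for P
  proof -
    let ?s = "\<lambda>n g. \<integral>p. \<beta> n (- p + g) \<partial>count_space P"
    have fin: "finite {p\<in>P. \<beta> n (- p + g) \<noteq> 0}" for n g
      by (rule finite_subset[of _ "{p\<in>P. - p + g \<in> K n}"]) (use N[OF P] \<beta>(3) in auto)
    have int: "integrable (count_space P) (\<lambda>p. \<beta> n (- p + g))" for n g
    proof -
      have "(\<integral>\<^sup>+ p. ennreal (norm (\<beta> n (- p + g))) \<partial>count_space P) < \<infinity>"
        using fin[of n g] by (subst nn_integral_count_space) (auto simp: less_top[symmetric] \<beta>(1) less_le)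
      then show ?thesis by (simp add: integrable_iff_bounded)
    qed
    have s: "0 \<le> ?s n g" "?s n g \<le> real (N n)" for n g
    proof -
      show "0 \<le> ?s n g" by (simp add: \<beta>(1))
      have "?s n g = (\<Sum>p | p \<in> P \<and> \<beta> n (- p + g) \<noteq> 0. \<beta> n (- p + g))"
        using fin by (rule lebesgue_integral_count_space_finite_support)
      also have "\<dots> \<le> (\<Sum>p | p \<in> P \<and> \<beta> n (- p + g) \<noteq> 0. 1)"
        by (intro sum_mono \<beta>(2))
      also have "\<dots> = real (card {p\<in>P. \<beta> n (- p + g) \<noteq> 0})"
        by simp
      also have "\<dots> \<le> real (card {p\<in>P. - p + g \<in> K n})"
        using N[OF P] \<beta>(3) by (intro of_nat_mono card_mono) auto
      also have "\<dots> \<le> real (N n)"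
        using N[OF P] by (intro of_nat_mono) blast
      finally show "?s n g \<le> real (N n)" .
    qed
    have bnd': "norm (c n * ?s n g) \<le> (1 / 2) ^ n" for n g
    proof -
      have "c n * ?s n g \<le> c n * real (N n)"
        using c(1)[of n] s(2) by (intro mult_left_mono) auto
      then have "c n * ?s n g \<le> (1 / 2) ^ n"
        using c(3) by (rule order.trans)
      moreover have "0 \<le> c n * ?s n g"
        using c(1)[of n] s(1)[of n g] by simp
      ultimately show ?thesis by simp
    qed
    have summ': "summable (\<lambda>n. c n * ?s n g)" for g
      by (rule summable_comparison_test'[OF geo]) (rule bnd')
    \<comment> \<open>The facts 1 to 3 justify exchanging the series over \<open>n\<close> with the
      sum over \<open>P\<close>.\<close>
    have 1: "integrable (count_space P) (\<lambda>p. c n * \<beta> n (- p + g))" for n g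
      using int by simp
    have 2: "AE p in count_space P. summable (\<lambda>n. norm (c n * \<beta> n (- p + g)))" for g
      using summ c(1) \<beta>(1) by (simp add: abs_mult less_imp_le)
    have 3: "summable (\<lambda>n. \<integral>p. norm (c n * \<beta> n (- p + g)) \<partial>count_space P)" for g
      using summ' c(1) \<beta>(1) by (simp add: abs_mult less_imp_le)
    have "integrable (count_space P) (\<lambda>p. \<phi> (- p + g))" for g
      unfolding \<phi>_def by (rule integrable_suminf[OF 1 2 3])
    moreover have "(\<integral>p. \<phi> (- p + g) \<partial>count_space P) = (\<Sum>n. c n * ?s n g)" for g
      unfolding \<phi>_def by (subst integral_suminf[OF 1 2 3]) simp
    moreover have "continuous_on UNIV (\<lambda>g. \<Sum>n. c n * ?s n g)"
      by (rule uniform_limit_theorem[OF _ Weierstrass_m_test[OF bnd' geo]])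
        (auto intro!: always_eventually continuous_intros continuous_separated_sum[OF lc U K cont \<beta>(3) P])
    ultimately show ?thesis by simp
  qed
  ultimately show ?thesis by (intro that[of \<phi>]) auto
qed

section \<open>Measurability of sums over locally finite sets\<close>

lemma compact_exhaustion:
  assumes lc: "locally_compact_space (euclidean :: 'g::{t2_space, second_countable_topology} topology)"
  obtains L :: "nat \<Rightarrow> 'g::{t2_space, second_countable_topology} set" where "\<And>n. compact (L n)" "incseq L" "(\<Union>n. L n) = UNIV"
proof -
  obtain \<beta> :: "nat \<Rightarrow> 'g \<Rightarrow> real" and K where K: "\<And>n. compact (K n)" and "\<And>n. continuous_on UNIV (\<beta> n)"
    and "\<And>n g. 0 \<le> \<beta> n g" "\<And>n g. \<beta> n g \<le> 1"
    and \<beta>: "\<And>n g. g \<notin> K n \<Longrightarrow> \<beta> n g = 0" "\<And>g. \<exists>n. 0 < \<beta> n g"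
    by (rule bump_functions[OF lc]) (rule that, assumption+)
  have "g \<in> (\<Union>n. K n)" for g
  proof -
    obtain n where "0 < \<beta> n g" using \<beta>(2) by blast
    then have "g \<in> K n" using \<beta>(1)[of g n] by auto
    then show ?thesis by blast
  qed
  then have "(\<Union>n. \<Union>i\<le>n. K i) = UNIV"
    by blast
  moreover have "incseq (\<lambda>n. \<Union>i\<le>n. K i)"
    by (auto simp: incseq_def intro: order.trans)
  ultimately show ?thesis
    using K by (intro that[of "\<lambda>n. \<Union>i\<le>n. K i"]) (auto intro!: compact_UN)
qed

lemma nn_integral_count_space_indicator_Int:
  "(\<integral>\<^sup>+p. indicator A p \<partial>count_space P) = emeasure (count_space P) (A \<inter> P)"
proof -
  have "(\<integral>\<^sup>+p. indicator A p \<partial>count_space P) = (\<integral>\<^sup>+p. indicator (A \<inter> P) p \<partial>count_space P)"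
    by (rule nn_integral_cong) (auto simp: indicator_def)
  then show ?thesis by simp
qed

text \<open>Counts in compact sets determine everything: Dynkin's argument passes to Borel subsets
  of a compact set, an exhaustion to all Borel sets, and monotone approximation to nonnegative
  functions.\<close>

lemma measurable_sum_if_measurable_compact_count:
  fixes P :: "'x \<Rightarrow> 'g::{t2_space, second_countable_topology} set"
  assumes lc: "locally_compact_space (euclidean :: 'g topology)"
    and fin: "\<And>x L. x \<in> space M \<Longrightarrow> compact L \<Longrightarrow> finite (L \<inter> P x)"
    and meas: "\<And>L. compact L \<Longrightarrow> (\<lambda>x. emeasure (count_space (P x)) (L \<inter> P x)) \<in> borel_measurable M"
    and f: "f \<in> borel_measurable borel"
  shows "(\<lambda>x. \<integral>\<^sup>+p. f p \<partial>count_space (P x)) \<in> borel_measurable M"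
proof -
  \<comment> \<open>Intersecting with a compact \<open>L\<close> keeps the counts finite, which the
    subtraction for complements requires.\<close>
  have local: "(\<lambda>x. emeasure (count_space (P x)) (A \<inter> L \<inter> P x)) \<in> borel_measurable M"
    if A: "A \<in> sets borel" and L: "compact L" for A L
  proof -
    have sig: "A \<in> sigma_sets UNIV (Collect closed)"
      using A by (simp add: borel_eq_closed)
    show ?thesis
    \<comment> \<open>Closed sets are an intersection-stable generator, and they meet
      \<open>L\<close> in compact sets, where \<open>meas\<close> applies.\<close>
    proof (rule sigma_sets_induct_disjoint[OF _ _ sig,
          where P = "\<lambda>A. (\<lambda>x. emeasure (count_space (P x)) (A \<inter> L \<inter> P x)) \<in> borel_measurable M"])
      show "Int_stable (Collect closed :: 'g set set)"
        by (auto simp: Int_stable_def)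
    next
      fix A :: "'g set" assume "A \<in> Collect closed"
      then show "(\<lambda>x. emeasure (count_space (P x)) (A \<inter> L \<inter> P x)) \<in> borel_measurable M"
        using L by (intro meas) (simp add: closed_Int_compact)
    next
      fix A :: "'g set"
      assume IH: "(\<lambda>x. emeasure (count_space (P x)) (A \<inter> L \<inter> P x)) \<in> borel_measurable M"
      have "emeasure (count_space (P x)) ((UNIV - A) \<inter> L \<inter> P x) =
          emeasure (count_space (P x)) (L \<inter> P x) - emeasure (count_space (P x)) (A \<inter> L \<inter> P x)"
        if x: "x \<in> space M" for x
      proof -
        have "(UNIV - A) \<inter> L \<inter> P x = L \<inter> P x - A \<inter> L \<inter> P x" by auto
        moreover have "finite (A \<inter> L \<inter> P x)"
          using fin[OF x L] by (rule rev_finite_subset) auto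
        ultimately show ?thesis
          by (simp only:) (rule emeasure_Diff, auto)
      qed
      moreover have "(\<lambda>x. emeasure (count_space (P x)) (L \<inter> P x) - emeasure (count_space (P x)) (A \<inter> L \<inter> P x))
          \<in> borel_measurable M"
        using IH meas[OF L] by measurable
      ultimately show "(\<lambda>x. emeasure (count_space (P x)) ((UNIV - A) \<inter> L \<inter> P x)) \<in> borel_measurable M"
        by (simp cong: measurable_cong)
    next
      fix A :: "nat \<Rightarrow> 'g set"
      assume dis: "disjoint_family A"
        and IH: "\<And>i. (\<lambda>x. emeasure (count_space (P x)) (A i \<inter> L \<inter> P x)) \<in> borel_measurable M"
      have "emeasure (count_space (P x)) ((\<Union>i. A i) \<inter> L \<inter> P x) =
          (\<Sum>i. emeasure (count_space (P x)) (A i \<inter> L \<inter> P x))" for x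
      proof -
        have "(\<Sum>i. emeasure (count_space (P x)) (A i \<inter> L \<inter> P x)) =
            emeasure (count_space (P x)) (\<Union>i. A i \<inter> L \<inter> P x)"
          using dis by (intro suminf_emeasure) (auto simp: disjoint_family_on_def)
        moreover have "(\<Union>i. A i \<inter> L \<inter> P x) = (\<Union>i. A i) \<inter> L \<inter> P x" by auto
        ultimately show ?thesis by simp
      qed
      then show "(\<lambda>x. emeasure (count_space (P x)) (\<Union> (range A) \<inter> L \<inter> P x)) \<in> borel_measurable M"
        using IH by simp
    qed auto
  qed
  obtain L :: "nat \<Rightarrow> 'g set" where L: "\<And>n. compact (L n)" "incseq L" "(\<Union>n. L n) = UNIV"
    by (rule compact_exhaustion[OF lc]) (rule that, assumption+)
  have set: "(\<lambda>x. \<integral>\<^sup>+p. indicator A p \<partial>count_space (P x)) \<in> borel_measurable M"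
    if A: "A \<in> sets borel" for A
  proof -
    have "(\<integral>\<^sup>+p. indicator A p \<partial>count_space (P x)) = (SUP n. emeasure (count_space (P x)) (A \<inter> L n \<inter> P x))" for x
    proof -
      have "(SUP n. emeasure (count_space (P x)) (A \<inter> L n \<inter> P x)) = emeasure (count_space (P x)) (\<Union>n. A \<inter> L n \<inter> P x)"
        using L(2) by (intro SUP_emeasure_incseq) (auto simp: incseq_def)
      moreover have "(\<Union>n. A \<inter> L n \<inter> P x) = A \<inter> P x"
        using L(3) by auto
      ultimately show ?thesis
        by (simp add: nn_integral_count_space_indicator_Int)
    qed
    then show ?thesis
      using local[OF A L(1)] by simp
  qed
  show ?thesis
    using f
  proof (induction rule: borel_measurable_induct)
    case (cong f g)
    then have "f = g" by (auto simp: fun_eq_iff)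
    with cong show ?case by simp
  next
    case (set A)
    then show ?case by (rule \<open>\<And>A. A \<in> sets borel \<Longrightarrow> _\<close>)
  next
    case (mult u c)
    then show ?case by (simp add: nn_integral_cmult)
  next
    case (add u v)
    then show ?case by (simp add: nn_integral_add)
  next
    case (seq F)
    have "(\<integral>\<^sup>+p. (SUP i. F i) p \<partial>count_space (P x)) = (SUP i. \<integral>\<^sup>+p. F i p \<partial>count_space (P x))" for x
      using seq(3) by (simp add: image_comp nn_integral_monotone_convergence_SUP)
    then show ?case using seq by simp
  qed
qed

section \<open>Functions of tuples\<close>

text \<open>Restriction maps the whole function type onto the tuples, whose remaining coordinates
  are constantly \<open>undefined\<close>. Continuity can thus be tested on a topological type,
  where sequential criteria are available.\<close>

lemma continuous_map_tuples_iff: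
  fixes f :: "(nat \<Rightarrow> 'g::topological_space) \<Rightarrow> real"
  shows "continuous_map (product_topology (\<lambda>_. euclidean) {..n}) euclideanreal f \<longleftrightarrow>
    continuous_on UNIV (\<lambda>z. f (restrict z {..n}))"
proof
  assume f: "continuous_map (product_topology (\<lambda>_. euclidean) {..n}) euclideanreal f"
  have "continuous_map (product_topology (\<lambda>_. euclidean :: 'g topology) UNIV)
      (product_topology (\<lambda>_. euclidean) {..n}) (\<lambda>z. restrict z {..n})"
    by (rule continuous_map_coordinatewise_then_product) (auto intro: continuous_map_product_projection)
  then have "continuous_map euclidean (product_topology (\<lambda>_. euclidean :: 'g topology) {..n}) (\<lambda>z. restrict z {..n})"
    by (simp add: euclidean_product_topology)
  from continuous_map_compose[OF this f] show "continuous_on UNIV (\<lambda>z. f (restrict z {..n}))"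
    by (simp add: o_def)
next
  assume f: "continuous_on UNIV (\<lambda>z. f (restrict z {..n}))"
  have "continuous_map (product_topology (\<lambda>_. euclidean :: 'g topology) {..n})
      (product_topology (\<lambda>_. euclidean) UNIV) (\<lambda>z. z)"
  proof (rule continuous_map_coordinatewise_then_product)
    fix i :: nat
    show "continuous_map (product_topology (\<lambda>_. euclidean :: 'g topology) {..n}) euclidean (\<lambda>z. z i)"
    proof (cases "i \<le> n")
      case True
      then show ?thesis by (intro continuous_map_product_projection) simp
    next
      case False
      have "continuous_map (product_topology (\<lambda>_. euclidean :: 'g topology) {..n}) euclidean (\<lambda>z. undefined)"
        by simp
      then show ?thesis
        by (rule continuous_map_eq) (use False in \<open>auto simp: PiE_def extensional_def\<close>)
    qed
  qed simp
  then have "continuous_map (product_topology (\<lambda>_. euclidean :: 'g topology) {..n}) euclidean (\<lambda>z. z)"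
    by (simp add: euclidean_product_topology)
  moreover have "continuous_map euclidean euclideanreal (\<lambda>z. f (restrict z {..n}))"
    using f by simp
  ultimately have "continuous_map (product_topology (\<lambda>_. euclidean :: 'g topology) {..n}) euclideanreal
      ((\<lambda>z. f (restrict z {..n})) \<circ> (\<lambda>z. z))"
    by (rule continuous_map_compose)
  then show "continuous_map (product_topology (\<lambda>_. euclidean) {..n}) euclideanreal f"
    by (rule continuous_map_eq) (simp add: PiE_restrict)
qed

text \<open>Second countability lets measurability into the function space be checked
  coordinatewise; the coordinates beyond \<open>n\<close> are constant on the space of the product
  measure.\<close>

lemma measurable_tuples:
  fixes f :: "(nat \<Rightarrow> 'g::second_countable_topology) \<Rightarrow> real"
  assumes "continuous_map (product_topology (\<lambda>_. euclidean) {..n}) euclideanreal f"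
  shows "f \<in> borel_measurable (PiM {..n} (\<lambda>_. borel))"
proof -
  have [measurable]: "(\<lambda>z. f (restrict z {..n})) \<in> borel_measurable borel"
    using assms by (intro borel_measurable_continuous_onI) (simp add: continuous_map_tuples_iff)
  have "(\<lambda>z. z) \<in> borel_measurable (PiM {..n} (\<lambda>_. borel :: 'g measure))"
  proof (rule measurable_coordinatewise_then_product)
    fix i
    show "(\<lambda>z. z i) \<in> borel_measurable (PiM {..n} (\<lambda>_. borel :: 'g measure))"
    proof (cases "i \<le> n")
      case False
      have "(\<lambda>z. undefined) \<in> borel_measurable (PiM {..n} (\<lambda>_. borel :: 'g measure))"
        by simp
      then show ?thesis
        by (rule measurable_cong[THEN iffD1, rotated]) (use False in \<open>auto simp: space_PiM PiE_def extensional_def\<close>)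
    qed (simp add: measurable_component_singleton)
  qed
  then have "(\<lambda>z. f (restrict z {..n})) \<in> borel_measurable (PiM {..n} (\<lambda>_. borel :: 'g measure))"
    by measurable
  then show ?thesis
    by (rule measurable_cong[THEN iffD1, rotated]) (simp add: space_PiM PiE_restrict)
qed

lemma measurable_prism:
  fixes f :: "(nat \<Rightarrow> 'g::second_countable_topology) \<Rightarrow> real"
  assumes f: "continuous_map (product_topology (\<lambda>_. euclidean) {..Suc m}) euclideanreal f"
  shows "prism m f g \<in> borel_measurable (PiM {..m} (\<lambda>_. borel))"
proof -
  have "join m i g \<in> PiM {..m} (\<lambda>_. borel) \<rightarrow>\<^sub>M PiM {..Suc m} (\<lambda>_. borel)" if "i \<le> m" for i
    unfolding join_def
  proof (rule measurable_restrict)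
    fix j assume "j \<in> {..Suc m}"
    then show "(\<lambda>k. if j \<le> i then g j else k (j - 1)) \<in> borel_measurable (PiM {..m} (\<lambda>_. borel))"
      using that by (auto intro!: measurable_component_singleton)
  qed
  from measurable_compose[OF this measurable_tuples[OF f]] show ?thesis
    unfolding prism_def[abs_def] by (intro borel_measurable_sum borel_measurable_times) auto
qed

lemma continuous_prism:
  fixes f :: "(nat \<Rightarrow> 'g::topological_space) \<Rightarrow> real"
  assumes f: "continuous_map (product_topology (\<lambda>_. euclidean) {..Suc m}) euclideanreal f"
  shows "continuous_on UNIV (\<lambda>z. prism m f (restrict z {..m}) k)"
proof -
  have "continuous_on UNIV (\<lambda>z. f (join m i (restrict z {..m}) k))" if "i \<le> m" for i
  proof -
    have "continuous_on UNIV (\<lambda>z :: nat \<Rightarrow> 'g. if j \<le> i then z j else k (j - 1))" for j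
      by (cases "j \<le> i") (auto intro: continuous_on_product_coordinates)
    then have "continuous_on UNIV (\<lambda>z j. if j \<le> i then z j else k (j - 1))"
      by (rule continuous_on_coordinatewise_then_product)
    then have "continuous_on UNIV (\<lambda>z. f (restrict (\<lambda>j. if j \<le> i then z j else k (j - 1)) {..Suc m}))"
      by (rule continuous_on_compose2[OF f[unfolded continuous_map_tuples_iff]]) simp
    moreover have "join m i (restrict z {..m}) k = restrict (\<lambda>j. if j \<le> i then z j else k (j - 1)) {..Suc m}" for z
      using that by (auto simp: join_def fun_eq_iff)
    ultimately show ?thesis by simp
  qed
  then show ?thesis
    unfolding prism_def by (intro continuous_intros) auto
qed

lemma abs_prism_le:
  assumes "\<And>z. \<bar>f z\<bar> \<le> B"
  shows "\<bar>prism m f g k\<bar> \<le> (real m + 1) * B"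
proof -
  have "\<bar>prism m f g k\<bar> \<le> (\<Sum>i\<le>m. \<bar>(-1) ^ i * f (join m i g k)\<bar>)"
    unfolding prism_def by (rule sum_abs)
  also have "\<dots> \<le> (\<Sum>i\<le>m. B)"
    by (intro sum_mono) (simp add: abs_mult assms)
  finally show ?thesis by (simp add: algebra_simps)
qed

lemma prism_translate:
  assumes f: "\<And>z. z \<in> tuples (Suc m) \<Longrightarrow> f (\<lambda>j\<in>{..Suc m}. h + z j) = f z"
  shows "prism m f (\<lambda>j\<in>{..m}. h + g j) (\<lambda>j\<in>{..m}. h + k j) = prism m f g k"
  unfolding prism_def by (intro sum.cong refl) (simp add: join_translate f)

text \<open>By invariance, only the countably many values of \<open>u\<close> on tuples with entries in \<open>\<Lambda>\<close> matter.\<close>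

lemma measurable_on_countable_differences:
  fixes u :: "(nat \<Rightarrow> 'g::{topological_group_add, t2_space, second_countable_topology}) \<Rightarrow> real"
  assumes \<Lambda>: "countable \<Lambda>" and u: "\<And>h z. z \<in> tuples m \<Longrightarrow> u (\<lambda>j\<in>{..m}. h + z j) = u z"
  obtains v where "v \<in> borel_measurable (PiM {..m} (\<lambda>_. borel))"
    "\<forall>k\<in>tuples m. (\<forall>j\<le>m. - k 0 + k j \<in> \<Lambda>) \<longrightarrow> v k = u k"
proof -
  let ?N = "PiM {..m} (\<lambda>_. borel :: 'g measure)"
  define w where "w z = (if z \<in> {..m} \<rightarrow>\<^sub>E \<Lambda> then u z else 0)" for z
  have w: "w \<in> borel_measurable ?N"
  proof (rule measurable_discrete_difference[of "\<lambda>_. 0" _ _ "{..m} \<rightarrow>\<^sub>E \<Lambda>"])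
    show "countable ({..m} \<rightarrow>\<^sub>E \<Lambda>)"
      using \<Lambda> by (intro countable_PiE) auto
    fix z assume "z \<in> {..m} \<rightarrow>\<^sub>E \<Lambda>"
    then have "{z} = (\<Pi>\<^sub>E i\<in>{..m}. {z i})"
      using PiE_singleton[of z "{..m}"] by (simp add: PiE_iff)
    also have "\<dots> \<in> sets ?N"
      by (rule sets_PiM_I_finite) auto
    finally show "{z} \<in> sets ?N" .
  qed (auto simp: w_def)
  \<comment> \<open>Translating the first entry to 0 moves the relevant tuples into the countable
    set on which \<open>w\<close> records \<open>u\<close>.\<close>
  let ?d = "\<lambda>k :: nat \<Rightarrow> 'g. \<lambda>j\<in>{..m}. - k 0 + k j"
  have "?d \<in> ?N \<rightarrow>\<^sub>M ?N"
  proof (rule measurable_restrict)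
    fix j assume "j \<in> {..m}"
    then show "(\<lambda>k. - k 0 + k j) \<in> borel_measurable ?N"
      by (intro borel_measurable_continuous_Pair[where H = "\<lambda>a b. - a + b"] measurable_component_singleton continuous_intros)
        auto
  qed
  from measurable_compose[OF this w] have "(\<lambda>k. w (?d k)) \<in> borel_measurable ?N" .
  moreover have "\<forall>k\<in>tuples m. (\<forall>j\<le>m. - k 0 + k j \<in> \<Lambda>) \<longrightarrow> w (?d k) = u k"
  proof (intro ballI impI)
    fix k :: "nat \<Rightarrow> 'g" assume k: "k \<in> tuples m" "\<forall>j\<le>m. - k 0 + k j \<in> \<Lambda>"
    have "?d k \<in> {..m} \<rightarrow>\<^sub>E \<Lambda>"
      using k(2) by auto
    then show "w (?d k) = u k"
      using u[OF k(1), of "- k 0"] by (simp add: w_def)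
  qed
  ultimately show ?thesis
    by (rule that)
qed

text \<open>Choosing for each point a basic open set that isolates it injects \<open>S\<close> into
  a countable basis.\<close>

lemma countable_discrete:
  fixes S :: "'a::second_countable_topology set"
  assumes "discrete S"
  shows "countable S"
proof -
  obtain \<B> :: "'a set set" where \<B>: "countable \<B>" "topological_basis \<B>"
    using ex_countable_basis by blast
  have "\<exists>B\<in>\<B>. B \<inter> S = {x}" if x: "x \<in> S" for x
  proof -
    obtain T where T: "open T" "T \<inter> S = {x}"
      using assms x by (auto simp: discrete_def isolated_in_def)
    then obtain B where "B \<in> \<B>" "x \<in> B" "B \<subseteq> T"
      using topological_basisE[OF \<B>(2), of T x] by blast
    then show ?thesis
      using x T by blast
  qed
  then have "\<forall>x\<in>S. \<exists>B. B \<in> \<B> \<and> B \<inter> S = {x}"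
    by blast
  from bchoice[OF this] obtain c where c: "\<And>x. x \<in> S \<Longrightarrow> c x \<in> \<B>" "\<And>x. x \<in> S \<Longrightarrow> c x \<inter> S = {x}"
    by blast
  have "inj_on c S"
    by (rule inj_onI) (use c(2) in fastforce)
  moreover have "countable (c ` S)"
    using \<B>(1) c(1) by (auto intro: countable_subset)
  ultimately show ?thesis
    by (simp add: countable_image_inj_eq)
qed

section \<open>Averaging over a transverse system\<close>

text \<open>The discreteness of the return times is kept in two forms: the neighbourhood
  \<open>U\<close> isolating 0, and countability. The assumptions on \<open>\<phi>\<close> are the
  conclusions of \<open>weight_function\<close>.\<close>

locale separated_transverse_system =
  fixes act :: "'g::{topological_group_add, t2_space, second_countable_topology} \<Rightarrow> 'x \<Rightarrow> 'x"
    and M :: "'x measure" and Y :: "'x set" and U :: "'g set" and \<phi> :: "'g \<Rightarrow> real"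
  assumes lc: "locally_compact_space (euclidean :: 'g topology)"
    and sys: "integrable_transverse_system act M Y"
    and U: "open U" "0 \<in> U" "return_times act Y \<inter> U = {0}"
    and countable_return_times: "countable (return_times act Y)"
    and continuous_weight: "continuous_on UNIV \<phi>" and weight_pos: "\<And>g. 0 < \<phi> g"
    and integrable_weight: "\<And>P g. separated U P \<Longrightarrow> integrable (count_space P) (\<lambda>p. \<phi> (- p + g))"
    and continuous_weight_sum:
      "\<And>P. separated U P \<Longrightarrow> continuous_on UNIV (\<lambda>g. \<integral>p. \<phi> (- p + g) \<partial>count_space P)"
begin

lemma pmp: "pmp_action act M" and cross: "cross_section act M Y"
  using sys by (auto simp: integrable_transverse_system_def transverse_system_def)

sublocale prob_space M
  using pmp by (simp add: pmp_action_def)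

lemma act_zero: "x \<in> space M \<Longrightarrow> act 0 x = x"
  and act_add: "x \<in> space M \<Longrightarrow> act (g + h) x = act g (act h x)"
  and distr_act: "distr M M (act g) = M"
  using pmp by (auto simp: pmp_action_def)

lemma measurable_act: "act g \<in> M \<rightarrow>\<^sub>M M"
proof -
  have "(\<lambda>(g, x). act g x) \<in> borel \<Otimes>\<^sub>M M \<rightarrow>\<^sub>M M"
    using pmp by (simp add: pmp_action_def)
  from measurable_Pair2[OF this, of g] show ?thesis by simp
qed

lemma act_space: "x \<in> space M \<Longrightarrow> act g x \<in> space M"
  by (rule measurable_space[OF measurable_act])

text \<open>The inverses of the hitting times, so that \<open>G\<close> acts by left translations.\<close>

definition pts :: "'x \<Rightarrow> 'g set" where
  "pts x = {p. act (- p) x \<in> Y}"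

text \<open>The element \<open>- p + q\<close> carries the point \<open>act (- q) x\<close> of
  \<open>Y\<close> to the point \<open>act (- p) x\<close> of \<open>Y\<close>.\<close>

lemma pts_diff:
  assumes "x \<in> space M" "p \<in> pts x" "q \<in> pts x"
  shows "- p + q \<in> return_times act Y"
proof -
  have "act (- p + q) (act (- q) x) = act (- p) x"
    using assms(1) by (simp add: act_add[symmetric] act_space add.assoc)
  then show ?thesis
    using assms(2,3) by (force simp: return_times_def pts_def)
qed

lemma separated_pts: "x \<in> space M \<Longrightarrow> separated U (pts x)"
  unfolding separated_def
proof (intro ballI impI)
  fix p q assume "x \<in> space M" "p \<in> pts x" "q \<in> pts x" "- p + q \<in> U"
  then have "- p + q \<in> return_times act Y \<inter> U"
    using pts_diff by blast
  then have "- p + q = 0"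
    using U(3) by simp
  then show "p = q"
    by (metis add.right_neutral add_minus_cancel)
qed

lemma pts_act: "x \<in> space M \<Longrightarrow> p \<in> pts (act h x) \<longleftrightarrow> - h + p \<in> pts x"
  by (simp add: pts_def act_add[symmetric] minus_add)

lemma bij_betw_pts_act:
  assumes "x \<in> space M"
  shows "bij_betw ((+) h) (pts x) (pts (act h x))"
  by (rule bij_betw_byWitness[of _ "(+) (- h)"])
    (use assms in \<open>auto simp: pts_act add.assoc[symmetric]\<close>)

text \<open>That \<open>Y\<close> meets every orbit is used here; it makes the normalizing weight of
  the random choice nonzero.\<close>

lemma pts_nonempty:
  assumes x: "x \<in> space M"
  shows "pts x \<noteq> {}"
proof -
  have "x \<in> (\<Union>g. act g ` Y)"
    using cross x unfolding cross_section_def by blast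
  then obtain g y where "y \<in> Y" "x = act g y"
    by blast
  moreover have "Y \<subseteq> space M"
    using cross sets.sets_into_space by (auto simp: cross_section_def)
  ultimately have "g \<in> pts x"
    by (auto simp: pts_def act_add[symmetric] act_zero subset_iff)
  then show ?thesis by blast
qed

text \<open>Inversion identifies the points in a compact \<open>L\<close> with hitting times in the
  inverse of \<open>L\<close>. Finiteness of their number comes from local finiteness, measurability
  from integrability of the system.\<close>

lemma measurable_pts_sum:
  assumes f: "f \<in> borel_measurable borel"
  shows "(\<lambda>x. \<integral>\<^sup>+p. f p \<partial>count_space (pts x)) \<in> borel_measurable M"
proof (rule measurable_sum_if_measurable_compact_count[OF lc _ _ f])
  have bij: "bij_betw uminus (L \<inter> pts x) (hitting_times act Y x \<inter> uminus ` L)" for L x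
    by (rule bij_betw_byWitness[of _ uminus]) (auto simp: pts_def hitting_times_def)
  have compact: "compact (uminus ` L)" if "compact L" for L :: "'g set"
    by (rule compact_continuous_image[OF _ that]) (intro continuous_intros)
  show fin: "finite (L \<inter> pts x)" if "x \<in> space M" "compact L" for x L
    using cross that compact[OF that(2)] bij_betw_finite[OF bij, of L x] by (auto simp: cross_section_def)
  show "(\<lambda>x. emeasure (count_space (pts x)) (L \<inter> pts x)) \<in> borel_measurable M" if L: "compact L" for L
  proof -
    have "(\<lambda>x. ennreal (real (card (hitting_times act Y x \<inter> uminus ` L)))) \<in> borel_measurable M"
      using sys compact[OF L] by (intro measurable_compose[OF _ measurable_ennreal])
        (auto simp: integrable_transverse_system_def)
    moreover have "emeasure (count_space (pts x)) (L \<inter> pts x) =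
        ennreal (real (card (hitting_times act Y x \<inter> uminus ` L)))" if "x \<in> space M" for x
      using fin[OF that L] bij_betw_same_card[OF bij, of L x]
      by (simp add: ennreal_of_nat_eq_real_of_nat)
    ultimately show ?thesis
      by (simp cong: measurable_cong)
  qed
qed

section \<open>The equivariant random point\<close>

definition weight_sum :: "'x \<Rightarrow> 'g \<Rightarrow> real" where
  "weight_sum x g = (\<integral>p. \<phi> (- p + g) \<partial>count_space (pts x))"

lemma nn_integral_weight:
  assumes "x \<in> space M"
  shows "(\<integral>\<^sup>+p. ennreal (\<phi> (- p + g)) \<partial>count_space (pts x)) = ennreal (weight_sum x g)"
  unfolding weight_sum_def
  by (rule nn_integral_eq_integral) (use assms in \<open>auto simp: integrable_weight separated_pts less_imp_le weight_pos\<close>)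

lemma weight_sum_pos:
  assumes x: "x \<in> space M"
  shows "0 < weight_sum x g"
proof -
  have "weight_sum x g \<noteq> 0"
    unfolding weight_sum_def
    by (subst integral_nonneg_eq_0_iff_AE)
      (use x pts_nonempty[OF x] weight_pos in
        \<open>auto simp: integrable_weight separated_pts less_imp_le AE_count_space less_le\<close>)
  moreover have "0 \<le> weight_sum x g"
    unfolding weight_sum_def by (simp add: less_imp_le weight_pos)
  ultimately show ?thesis by simp
qed

lemma weight_sum_act:
  assumes x: "x \<in> space M"
  shows "weight_sum (act h x) (h + g) = weight_sum x g"
proof -
  have "weight_sum x g = (\<integral>p. \<phi> (- (h + p) + (h + g)) \<partial>count_space (pts x))"
    by (simp only: weight_sum_def minus_add add.assoc minus_add_cancel)
  also have "\<dots> = weight_sum (act h x) (h + g)"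
    unfolding weight_sum_def by (rule integral_bij_count_space[OF bij_betw_pts_act[OF x]])
  finally show ?thesis ..
qed

definition choice_pmf :: "'x \<Rightarrow> 'g \<Rightarrow> 'g pmf" where
  "choice_pmf x g = embed_pmf (\<lambda>p. if p \<in> pts x then \<phi> (- p + g) / weight_sum x g else 0)"

lemma pmf_choice:
  assumes x: "x \<in> space M"
  shows "pmf (choice_pmf x g) p = (if p \<in> pts x then \<phi> (- p + g) / weight_sum x g else 0)"
  unfolding choice_pmf_def
proof (rule pmf_embed_pmf)
  show "0 \<le> (if p \<in> pts x then \<phi> (- p + g) / weight_sum x g else 0)" for p
    using weight_sum_pos[OF x, of g] weight_pos[of "- p + g"] by simp
  have "(\<integral>\<^sup>+p. ennreal (if p \<in> pts x then \<phi> (- p + g) / weight_sum x g else 0) \<partial>count_space UNIV) =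
      (\<integral>\<^sup>+p. ennreal (\<phi> (- p + g) / weight_sum x g) * indicator (pts x) p \<partial>count_space UNIV)"
    by (rule nn_integral_cong) (simp add: indicator_def)
  also have "\<dots> = (\<integral>\<^sup>+p. ennreal (\<phi> (- p + g) / weight_sum x g) \<partial>count_space (pts x))"
    by (subst nn_integral_count_space_indicator) auto
  also have "\<dots> = (\<integral>\<^sup>+p. ennreal (\<phi> (- p + g)) / ennreal (weight_sum x g) \<partial>count_space (pts x))"
    using weight_sum_pos[OF x, of g] weight_pos by (simp add: divide_ennreal less_imp_le)
  also have "\<dots> = 1"
    using weight_sum_pos[OF x, of g] by (simp add: nn_integral_divide nn_integral_weight[OF x] divide_ennreal)
  finally show "(\<integral>\<^sup>+p. ennreal (if p \<in> pts x then \<phi> (- p + g) / weight_sum x g else 0) \<partial>count_space UNIV) = 1" .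
qed

lemma set_choice: "x \<in> space M \<Longrightarrow> set_pmf (choice_pmf x g) \<subseteq> pts x"
  by (auto simp: set_pmf_eq pmf_choice)

lemma choice_act:
  assumes x: "x \<in> space M"
  shows "choice_pmf (act h x) (h + g) = map_pmf ((+) h) (choice_pmf x g)"
proof (rule pmf_eqI)
  fix p
  have "pmf (map_pmf ((+) h) (choice_pmf x g)) (h + (- h + p)) = pmf (choice_pmf x g) (- h + p)"
    by (rule pmf_map_inj') (simp add: inj_on_def)
  then show "pmf (choice_pmf (act h x) (h + g)) p = pmf (map_pmf ((+) h) (choice_pmf x g)) p"
    using x by (simp add: pmf_choice act_space pts_act weight_sum_act minus_add add.assoc add.assoc[symmetric, of h])
qed

text \<open>The weight of \<open>p\<close> and the total weight are continuous in the base point,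
  and the total weight is positive. Pointwise convergence of masses is the form needed for
  \<open>tendsto_expectation_pmf\<close>.\<close>

lemma tendsto_choice:
  assumes x: "x \<in> space M" and g: "a \<longlonglongrightarrow> g"
  shows "(\<lambda>k. pmf (choice_pmf x (a k)) p) \<longlonglongrightarrow> pmf (choice_pmf x g) p"
proof -
  have "isCont \<phi> (- p + g)" "isCont (weight_sum x) g"
    using continuous_weight continuous_weight_sum[OF separated_pts[OF x]]
    by (simp_all add: continuous_on_eq_continuous_at weight_sum_def[abs_def])
  then have "(\<lambda>k. \<phi> (- p + a k)) \<longlonglongrightarrow> \<phi> (- p + g)" "(\<lambda>k. weight_sum x (a k)) \<longlonglongrightarrow> weight_sum x g"
    using g by (auto intro!: isCont_tendsto_compose[of _ \<phi>] isCont_tendsto_compose[of _ "weight_sum x"] tendsto_intros)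
  then show ?thesis
    using weight_sum_pos[OF x, of g] by (auto simp: pmf_choice[OF x] intro!: tendsto_divide)
qed

text \<open>The probability of \<open>A\<close> is a quotient of two sums of Borel functions over
  \<open>pts x\<close>, so \<open>measurable_pts_sum\<close> applies to both.\<close>

lemma measurable_choice:
  assumes A: "A \<in> sets borel"
  shows "(\<lambda>x. measure_pmf.prob (choice_pmf x g) A) \<in> borel_measurable M"
proof -
  note [measurable] = A
  have "continuous_on UNIV (\<lambda>p. \<phi> (- p + g))"
    by (intro continuous_on_compose2[OF continuous_weight] continuous_intros) auto
  then have [measurable]: "(\<lambda>p. \<phi> (- p + g)) \<in> borel_measurable borel"
    by (rule borel_measurable_continuous_onI)
  have "emeasure (choice_pmf x g) A = (\<integral>\<^sup>+p. ennreal (\<phi> (- p + g)) * indicator A p \<partial>count_space (pts x)) /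
      (\<integral>\<^sup>+p. ennreal (\<phi> (- p + g)) \<partial>count_space (pts x))" if x: "x \<in> space M" for x
  proof -
    have "emeasure (choice_pmf x g) A = (\<integral>\<^sup>+p. pmf (choice_pmf x g) p \<partial>count_space A)"
      by (rule nn_integral_pmf[symmetric])
    also have "\<dots> = (\<integral>\<^sup>+p. pmf (choice_pmf x g) p * indicator A p \<partial>count_space UNIV)"
      by (subst nn_integral_count_space_indicator) (auto intro!: nn_integral_cong simp: indicator_def)
    also have "\<dots> = (\<integral>\<^sup>+p. ennreal (\<phi> (- p + g)) * indicator A p / ennreal (weight_sum x g) * indicator (pts x) p \<partial>count_space UNIV)"
      using weight_sum_pos[OF x, of g] weight_pos
      by (intro nn_integral_cong) (auto simp: pmf_choice[OF x] divide_ennreal less_imp_le indicator_def)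
    also have "\<dots> = (\<integral>\<^sup>+p. ennreal (\<phi> (- p + g)) * indicator A p / ennreal (weight_sum x g) \<partial>count_space (pts x))"
      by (subst (2) nn_integral_count_space_indicator) auto
    finally show ?thesis
      by (simp add: nn_integral_divide nn_integral_weight[OF x])
  qed
  moreover have "(\<lambda>x. (\<integral>\<^sup>+p. ennreal (\<phi> (- p + g)) * indicator A p \<partial>count_space (pts x)) /
      (\<integral>\<^sup>+p. ennreal (\<phi> (- p + g)) \<partial>count_space (pts x))) \<in> borel_measurable M"
    by (intro borel_measurable_divide_ennreal measurable_pts_sum; measurable)
  ultimately have "(\<lambda>x. emeasure (choice_pmf x g) A) \<in> borel_measurable M"
    by (simp cong: measurable_cong)
  then show ?thesis
    unfolding measure_def by measurable
qed

section \<open>Independent samples along a tuple\<close>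

definition sample :: "nat \<Rightarrow> 'x \<Rightarrow> (nat \<Rightarrow> 'g) \<Rightarrow> (nat \<Rightarrow> 'g) pmf" where
  "sample m x g = Pi_pmf {..m} undefined (\<lambda>i. choice_pmf x (g i))"

lemma set_sample:
  assumes "x \<in> space M" "k \<in> set_pmf (sample m x g)"
  shows "k \<in> {..m} \<rightarrow>\<^sub>E pts x"
  using assms set_choice by (fastforce simp: sample_def set_Pi_pmf PiE_dflt_def PiE_def extensional_def)

lemma sample_act:
  assumes x: "x \<in> space M"
  shows "sample m (act h x) (\<lambda>j\<in>{..m}. h + g j) = map_pmf (\<lambda>k. \<lambda>j\<in>{..m}. h + k j) (sample m x g)"
proof -
  have "map_pmf (\<lambda>k. \<lambda>j\<in>{..m}. h + k (id j)) (sample m x g) =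
      Pi_pmf {..m} undefined (\<lambda>j. map_pmf ((+) h) (choice_pmf x (g (id j))))"
    unfolding sample_def by (rule map_Pi_pmf_reindex) auto
  also have "\<dots> = sample m (act h x) (\<lambda>j\<in>{..m}. h + g j)"
    unfolding sample_def by (intro Pi_pmf_cong) (auto simp: choice_act[OF x])
  finally show ?thesis by simp
qed

text \<open>A marginal of an independent family is independent. This allows all faces of a tuple to
  be averaged over a single sample.\<close>

lemma sample_omit:
  assumes l: "l \<le> Suc m"
  shows "sample m x (omit m l g) = map_pmf (omit m l) (sample (Suc m) x g)"
proof -
  let ?s = "\<lambda>j. if j < l then j else Suc j"
  have "map_pmf (\<lambda>k. \<lambda>j\<in>{..m}. id (k (?s j))) (sample (Suc m) x g) =
      Pi_pmf {..m} undefined (\<lambda>j. map_pmf id (choice_pmf x (g (?s j))))"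
    unfolding sample_def by (rule map_Pi_pmf_reindex) (use l in \<open>auto simp: inj_on_def split: if_splits\<close>)
  also have "\<dots> = sample m x (omit m l g)"
    unfolding sample_def by (intro Pi_pmf_cong) (auto simp: omit_def pmf.map_id)
  finally show ?thesis by (simp add: omit_def[abs_def])
qed

lemma tendsto_sample:
  assumes x: "x \<in> space M" and g: "\<And>i. i \<le> m \<Longrightarrow> (\<lambda>n. a n i) \<longlonglongrightarrow> g i"
  shows "(\<lambda>n. pmf (sample m x (a n)) k) \<longlonglongrightarrow> pmf (sample m x g) k"
proof (cases "\<forall>i. i \<notin> {..m} \<longrightarrow> k i = undefined")
  case True
  then show ?thesis
    unfolding sample_def by (auto simp: pmf_Pi intro!: tendsto_prod tendsto_choice x g)
next
  case False
  then show ?thesis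
    by (simp only: sample_def pmf_Pi finite_atMost if_False tendsto_const)
qed

text \<open>The law of the sample is a measurable kernel into the product space: this is checked on
  boxes, where independence gives a finite product of probabilities covered by
  \<open>measurable_choice\<close>. Integrals against a measurable kernel are measurable.\<close>

lemma measurable_sample_expectation:
  assumes h: "h \<in> borel_measurable (PiM {..m} (\<lambda>_. borel))"
  shows "(\<lambda>x. measure_pmf.expectation (sample m x g) h :: real) \<in> borel_measurable M"
proof -
  let ?N = "PiM {..m} (\<lambda>_. borel :: 'g measure)"
  let ?\<Omega> = "\<Pi>\<^sub>E i\<in>{..m}. space (borel :: 'g measure)"
  \<comment> \<open>Every set is measurable for \<open>measure_pmf p\<close>, so only the range
    matters; \<open>restrict\<close> forces it into the extensional functions and is the identity on
    the support of a sample.\<close>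
  have r: "(\<lambda>k. restrict k {..m}) \<in> measure_pmf p \<rightarrow>\<^sub>M ?N" for p :: "(nat \<Rightarrow> 'g) pmf"
    by (auto simp: measurable_def space_PiM)
  define K where "K x = distr (measure_pmf (sample m x g)) ?N (\<lambda>k. restrict k {..m})" for x
  have K: "K \<in> M \<rightarrow>\<^sub>M subprob_algebra ?N"
  proof (rule measurable_subprob_algebra_generated[OF sets_PiM])
    show "Int_stable (prod_algebra {..m} (\<lambda>_. borel :: 'g measure))"
      by (rule Int_stable_prod_algebra)
    show "prod_algebra {..m} (\<lambda>_. borel :: 'g measure) \<subseteq> Pow ?\<Omega>"
      by (rule prod_algebra_sets_into_space)
    show "subprob_space (K x)" for x
      unfolding K_def by (intro prob_space_imp_subprob_space measure_pmf.prob_space_distr r)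
    show "sets (K x) = sets ?N" for x
      by (simp add: K_def)
    have "emeasure (K x) ?\<Omega> = 1" for x
    proof -
      have "prob_space (K x)"
        unfolding K_def by (intro measure_pmf.prob_space_distr r)
      from prob_space.emeasure_space_1[OF this] show ?thesis
        by (simp add: K_def space_PiM)
    qed
    then show "(\<lambda>x. emeasure (K x) ?\<Omega>) \<in> borel_measurable M"
      by simp
    fix A assume "A \<in> prod_algebra {..m} (\<lambda>_. borel :: 'g measure)"
    then obtain X where X: "A = (\<Pi>\<^sub>E i\<in>{..m}. X i)" "\<And>i. i \<le> m \<Longrightarrow> X i \<in> sets borel"
      by (auto simp: prod_algebra_eq_finite)
    have "emeasure (K x) A = ennreal (\<Prod>i\<le>m. measure_pmf.prob (choice_pmf x (g i)) (X i))" for x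
    proof -
      have "emeasure (K x) A = emeasure (sample m x g) ((\<lambda>k. restrict k {..m}) -` A \<inter> UNIV)"
        unfolding K_def using X by (subst emeasure_distr[OF r]) (auto intro!: sets_PiM_I_finite)
      also have "(\<lambda>k. restrict k {..m}) -` A \<inter> UNIV = Pi {..m} X"
        by (auto simp: X)
      finally show ?thesis
        by (simp add: measure_pmf.emeasure_eq_measure sample_def measure_Pi_pmf_Pi)
    qed
    then show "(\<lambda>x. emeasure (K x) A) \<in> borel_measurable M"
      using X measurable_choice by simp
  qed
  have "(\<lambda>x. integral\<^sup>L (K x) h) \<in> borel_measurable M"
    using measurable_compose[OF K integral_measurable_subprob_algebra[OF h]] .
  moreover have "integral\<^sup>L (K x) h = measure_pmf.expectation (sample m x g) h" for x
  proof -
    have "integral\<^sup>L (K x) h = measure_pmf.expectation (sample m x g) (\<lambda>k. h (restrict k {..m}))"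
      unfolding K_def by (rule integral_distr[OF r h])
    also have "\<dots> = measure_pmf.expectation (sample m x g) h"
    proof (rule integral_cong_AE)
      have "restrict k {..m} = k" if "k \<in> set_pmf (sample m x g)" for k
        using that set_Pi_pmf_subset[of "{..m}" undefined] by (fastforce simp: sample_def fun_eq_iff)
      then show "AE k in sample m x g. h (restrict k {..m}) = h k"
        by (simp add: AE_measure_pmf_iff)
    qed auto
    finally show ?thesis .
  qed
  ultimately show ?thesis by simp
qed

section \<open>The averaged primitive\<close>

text \<open>For every sampled tuple \<open>k\<close>, the alternating sum of
  \<open>u - prism\<close> over the faces is \<open>f k - (f k - f g) = f g\<close>. This survives
  averaging over \<open>k\<close> and \<open>x\<close>, while averaging supplies continuity in
  \<open>g\<close> and invariance.\<close>

lemma continuous_primitive_if_discrete_primitive: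
  assumes f: "f \<in> bounded_cochains euclidean (Suc m)" and u: "u \<in> bounded_cochains (discrete_topology UNIV) m"
    and fu: "f = coboundary m u"
  shows "\<exists>b \<in> bounded_cochains (euclidean :: 'g topology) m. coboundary m b = f"
proof -
  define H where "H g k = u k - prism m f g k" for g k
  have f_cont: "continuous_map (product_topology (\<lambda>_. euclidean) {..Suc m}) euclideanreal f"
    and f_inv: "\<And>h z. z \<in> tuples (Suc m) \<Longrightarrow> f (\<lambda>j\<in>{..Suc m}. h + z j) = f z"
    using f by (auto simp: bounded_cochains_def)
  have u_inv: "\<And>h z. z \<in> tuples m \<Longrightarrow> u (\<lambda>j\<in>{..m}. h + z j) = u z"
    using u by (auto simp: bounded_cochains_def)
  obtain B where B: "\<And>z. \<bar>f z\<bar> \<le> B"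
    using f by (auto simp: bounded_cochains_def bounded_iff)
  obtain B' where B': "\<And>z. \<bar>u z\<bar> \<le> B'"
    using u by (auto simp: bounded_cochains_def bounded_iff)
  define C where "C = B' + (real m + 1) * B"
  have H_bound: "\<bar>H g k\<bar> \<le> C" for g k
    using abs_prism_le[of f B m g k, OF B] B'[of k] by (simp add: H_def C_def)
  define E where "E x g = measure_pmf.expectation (sample m x g) (H g)" for x g
  have E_bound: "\<bar>E x g\<bar> \<le> C" for x g
    unfolding E_def by (rule expectation_pmf_bounded) (rule H_bound)
  \<comment> \<open>The cochain \<open>u\<close> may be nonmeasurable. Only its values on supports
    of samples enter, where differences of entries are return times and \<open>u\<close> agrees with
    a measurable \<open>v\<close>.\<close>
  have E_meas: "(\<lambda>x. E x g) \<in> borel_measurable M" for g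
  proof -
    obtain v where v: "v \<in> borel_measurable (PiM {..m} (\<lambda>_. borel))"
      "\<forall>k\<in>tuples m. (\<forall>j\<le>m. - k 0 + k j \<in> return_times act Y) \<longrightarrow> v k = u k"
      by (rule measurable_on_countable_differences[OF countable_return_times u_inv])
        (assumption, rule that, assumption+)
    have "(\<lambda>k. v k - prism m f g k) \<in> borel_measurable (PiM {..m} (\<lambda>_. borel))"
      using v(1) measurable_prism[OF f_cont] by measurable
    then have "(\<lambda>x. measure_pmf.expectation (sample m x g) (\<lambda>k. v k - prism m f g k)) \<in> borel_measurable M"
      by (rule measurable_sample_expectation)
    moreover have "measure_pmf.expectation (sample m x g) (\<lambda>k. v k - prism m f g k) = E x g"
      if x: "x \<in> space M" for x
      unfolding E_def
    proof (rule integral_cong_AE)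
      have "v k = u k" if "k \<in> set_pmf (sample m x g)" for k
      proof -
        have "k \<in> {..m} \<rightarrow>\<^sub>E pts x"
          using x that by (rule set_sample)
        then have "k \<in> tuples m" "\<forall>j\<le>m. - k 0 + k j \<in> return_times act Y"
          by (auto simp: tuples_def intro!: pts_diff[OF x])
        then show ?thesis
          using v(2) by blast
      qed
      then show "AE k in sample m x g. v k - prism m f g k = H g k"
        by (simp add: AE_measure_pmf_iff H_def)
    qed auto
    ultimately show ?thesis by (simp cong: measurable_cong)
  qed
  have E_int: "integrable M (\<lambda>x. E x g)" for g
    by (rule integrable_const_bound[where B = C]) (use E_bound E_meas in auto)
  define b where "b g = (if g \<in> tuples m then expectation (\<lambda>x. E x g) else 0)" for g
  \<comment> \<open>For fixed \<open>x\<close> the law of the sample and the prism term both vary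
    with the tuple, which \<open>tendsto_expectation_pmf\<close> handles; the uniform bound
    \<open>C\<close> then permits passing to the limit under the integral over
    \<open>x\<close>.\<close>
  have b_cont: "continuous_map (product_topology (\<lambda>_. euclidean) {..m}) euclideanreal b"
    unfolding continuous_map_tuples_iff continuous_on_def tendsto_at_iff_sequentially
  proof (intro ballI allI impI)
    fix z Z
    assume Z: "Z \<longlonglongrightarrow> (z :: nat \<Rightarrow> 'g)"
    have coord: "(\<lambda>n. Z n i) \<longlonglongrightarrow> z i" for i
      by (rule continuous_on_tendsto_compose[OF continuous_on_product_coordinates Z]) auto
    have "(\<lambda>n. expectation (\<lambda>x. E x (restrict (Z n) {..m}))) \<longlonglongrightarrow> expectation (\<lambda>x. E x (restrict z {..m}))"
    proof (rule integral_dominated_convergence[where w = "\<lambda>_. C"])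
      show "AE x in M. (\<lambda>n. E x (restrict (Z n) {..m})) \<longlonglongrightarrow> E x (restrict z {..m})"
      proof (rule AE_I2)
        fix x assume x: "x \<in> space M"
        show "(\<lambda>n. E x (restrict (Z n) {..m})) \<longlonglongrightarrow> E x (restrict z {..m})"
          unfolding E_def
        proof (rule tendsto_expectation_pmf)
          show "(\<lambda>n. pmf (sample m x (restrict (Z n) {..m})) k) \<longlonglongrightarrow> pmf (sample m x (restrict z {..m})) k" for k
            by (rule tendsto_sample[OF x]) (simp add: coord)
          have "(\<lambda>n. prism m f (restrict (Z n) {..m}) k) \<longlonglongrightarrow> prism m f (restrict z {..m}) k" for k
            by (rule continuous_on_tendsto_compose[OF continuous_prism[OF f_cont] Z]) auto
          then show "(\<lambda>n. H (restrict (Z n) {..m}) k) \<longlonglongrightarrow> H (restrict z {..m}) k" for k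
            unfolding H_def by (rule tendsto_diff[OF tendsto_const])
        qed (rule H_bound)
      qed
    qed (use E_meas E_bound in auto)
    then show "((\<lambda>z. b (restrict z {..m})) \<circ> Z) \<longlonglongrightarrow> b (restrict z {..m})"
      by (simp add: b_def tuples_def o_def)
  qed
  have b_bound: "\<bar>b g\<bar> \<le> C" for g
  proof -
    have "\<bar>expectation (\<lambda>x. E x g)\<bar> \<le> expectation (\<lambda>x. \<bar>E x g\<bar>)"
      by (rule integral_abs_bound)
    also have "\<dots> \<le> expectation (\<lambda>_. C)"
      by (intro integral_mono integrable_abs E_int) (simp_all add: E_bound)
    finally have "\<bar>expectation (\<lambda>x. E x g)\<bar> \<le> C"
      by (simp add: prob_space)
    moreover have "0 \<le> C"
      using H_bound[of g g] by simp
    ultimately show ?thesis by (simp add: b_def)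
  qed
  have b_inv: "b (\<lambda>j\<in>{..m}. h + g j) = b g" if g: "g \<in> tuples m" for h g
  proof -
    let ?hg = "\<lambda>j\<in>{..m}. h + g j"
    \<comment> \<open>Invariance of the measure replaces \<open>x\<close> by \<open>act h x\<close>;
      equivariance of the sample and invariance of \<open>u\<close> and \<open>f\<close> then remove
      \<open>h\<close>.\<close>
    have "expectation (\<lambda>x. E x ?hg) = integral\<^sup>L (distr M M (act h)) (\<lambda>x. E x ?hg)"
      by (simp add: distr_act)
    also have "\<dots> = expectation (\<lambda>x. E (act h x) ?hg)"
      by (rule integral_distr[OF measurable_act E_meas])
    also have "\<dots> = expectation (\<lambda>x. E x g)"
    proof (rule Bochner_Integration.integral_cong[OF refl])
      fix x assume x: "x \<in> space M"
      have "E (act h x) ?hg = measure_pmf.expectation (sample m x g) (\<lambda>k. H ?hg (\<lambda>j\<in>{..m}. h + k j))"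
        by (simp add: E_def sample_act[OF x])
      also have "\<dots> = E x g"
        unfolding E_def
      proof (rule integral_cong_AE)
        have "H ?hg (\<lambda>j\<in>{..m}. h + k j) = H g k" if "k \<in> set_pmf (sample m x g)" for k
        proof -
          have "k \<in> tuples m"
            using set_sample[OF x that] by (auto simp: tuples_def)
          then show ?thesis
            by (simp add: H_def u_inv prism_translate f_inv)
        qed
        then show "AE k in sample m x g. H ?hg (\<lambda>j\<in>{..m}. h + k j) = H g k"
          by (simp add: AE_measure_pmf_iff)
      qed auto
      finally show "E (act h x) ?hg = E x g" .
    qed
    finally show ?thesis
      using g by (simp add: b_def tuples_def)
  qed
  have "b \<in> bounded_cochains euclidean m"
    unfolding bounded_cochains_def
  proof (intro CollectI conjI allI ballI impI)
    show "bounded (range b)"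
      using b_bound by (auto simp: bounded_iff)
    show "b g = 0" if "g \<notin> tuples m" for g
      using that by (simp add: b_def)
  qed (fact b_cont, rule b_inv)
  moreover have "coboundary m b = f"
  proof
    fix g
    show "coboundary m b g = f g"
    proof (cases "g \<in> tuples (Suc m)")
      case True
      have "coboundary m b g = (\<Sum>l\<le>Suc m. (-1) ^ l * expectation (\<lambda>x. E x (omit m l g)))"
        using True by (simp add: coboundary_def b_def del: sum.atMost_Suc)
      also have "\<dots> = expectation (\<lambda>x. \<Sum>l\<le>Suc m. (-1) ^ l * E x (omit m l g))"
        by (subst Bochner_Integration.integral_sum) (auto intro!: E_int simp del: sum.atMost_Suc)
      also have "\<dots> = expectation (\<lambda>x. f g)"
      proof (rule Bochner_Integration.integral_cong[OF refl])
        fix x assume x: "x \<in> space M"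
        let ?S = "sample (Suc m) x g"
        have int: "integrable (measure_pmf ?S) (\<lambda>k. H (omit m l g) (omit m l k))" for l
          by (rule integrable_pmf_bounded) (rule H_bound)
        \<comment> \<open>All face averages are rewritten over the common sample \<open>?S\<close>,
          so that the alternating sum can be taken inside the expectation.\<close>
        have "(\<Sum>l\<le>Suc m. (-1) ^ l * E x (omit m l g)) =
            (\<Sum>l\<le>Suc m. (-1) ^ l * measure_pmf.expectation ?S (\<lambda>k. H (omit m l g) (omit m l k)))"
          by (intro sum.cong refl) (simp add: E_def sample_omit)
        also have "\<dots> = measure_pmf.expectation ?S (\<lambda>k. \<Sum>l\<le>Suc m. (-1) ^ l * H (omit m l g) (omit m l k))"
          by (subst Bochner_Integration.integral_sum) (auto intro!: int simp del: sum.atMost_Suc)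
        also have "\<dots> = measure_pmf.expectation ?S (\<lambda>_. f g)"
        proof (rule integral_cong_AE)
          have "(\<Sum>l\<le>Suc m. (-1) ^ l * H (omit m l g) (omit m l k)) = f g" if "k \<in> set_pmf ?S" for k
          proof -
            have k: "k \<in> tuples (Suc m)"
              using set_sample[OF x that] by (auto simp: tuples_def)
            have "(\<Sum>l\<le>Suc m. (-1) ^ l * H (omit m l g) (omit m l k)) =
                (\<Sum>l\<le>Suc m. (-1) ^ l * u (omit m l k)) - (\<Sum>l\<le>Suc m. (-1) ^ l * prism m f (omit m l g) (omit m l k))"
              by (simp add: H_def right_diff_distrib sum_subtractf del: sum.atMost_Suc)
            also have "(\<Sum>l\<le>Suc m. (-1) ^ l * u (omit m l k)) = f k"
              using k by (simp add: fu coboundary_def del: sum.atMost_Suc)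
            also have "(\<Sum>l\<le>Suc m. (-1) ^ l * prism m f (omit m l g) (omit m l k)) = f k - f g"
              by (rule prism_homotopy[OF _ True k]) (simp add: fu coboundary_coboundary)
            finally show ?thesis by simp
          qed
          then show "AE k in ?S. (\<Sum>l\<le>Suc m. (-1) ^ l * H (omit m l g) (omit m l k)) = f g"
            by (simp add: AE_measure_pmf_iff del: sum.atMost_Suc)
        qed auto
        finally show "(\<Sum>l\<le>Suc m. (-1) ^ l * E x (omit m l g)) = f g"
          by simp
      qed
      finally show ?thesis by (simp add: prob_space)
    next
      case False
      then show ?thesis by (simp add: fu coboundary_def)
    qed
  qed
  ultimately show ?thesis by (intro bexI)
qed

lemma discrete_coboundary_imp_continuous:
  assumes f: "f \<in> bounded_cocycles euclidean n" "f \<in> bounded_coboundaries (discrete_topology UNIV) n"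
  shows "f \<in> bounded_coboundaries (euclidean :: 'g topology) n"
proof (cases n)
  case 0
  then show ?thesis using f by (simp add: bounded_coboundaries_def)
next
  case (Suc m)
  then obtain u where u: "u \<in> bounded_cochains (discrete_topology UNIV) m" "f = coboundary m u"
    using f(2) by (auto simp: bounded_coboundaries_def)
  have "f \<in> bounded_cochains euclidean (Suc m)"
    using f(1) Suc by (simp add: bounded_cocycles_def)
  from continuous_primitive_if_discrete_primitive[OF this u] show ?thesis
    unfolding Suc bounded_coboundaries_def nat.case by blast
qed

end

section \<open>From discrete return times to separation and weights\<close>

theorem corollary9:
  fixes act :: "'g :: {topological_group_add, t2_space, second_countable_topology} \<Rightarrow> 'x \<Rightarrow> 'x"
    and M :: "'x measure"
    and Y :: "'x set"
  assumes "locally_compact_space (euclidean :: 'g topology)"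
    and "unimodular TYPE('g)"
    and "integrable_transverse_system act M Y"
    and "discrete (return_times act Y)"
  shows "\<forall>n. inj_on (discretization n) (carrier (cb_cohomology (euclidean :: 'g topology) n))"
proof -
  have sys: "pmp_action act M" "cross_section act M Y"
    using assms(3) by (auto simp: integrable_transverse_system_def transverse_system_def)
  \<comment> \<open>A probability space is nonempty and is covered by translates of
    \<open>Y\<close>, so \<open>Y\<close> has a point; hence 0 is a return time.\<close>
  then have "space M \<noteq> {}" "(\<Union>g. act g ` Y) = space M"
    unfolding pmp_action_def cross_section_def by (simp_all add: prob_space.not_empty)
  then obtain y where y: "y \<in> Y"
    by blast
  moreover have "Y \<subseteq> space M"
    using sys(2) sets.sets_into_space by (auto simp: cross_section_def)
  ultimately have "act 0 y = y"
    using sys(1) by (auto simp: pmp_action_def)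
  then have "0 \<in> return_times act Y"
    using y by (force simp: return_times_def)
  \<comment> \<open>Discreteness at 0 gives the separating neighbourhood; the other use of
    discreteness is \<open>countable_discrete\<close>.\<close>
  then obtain U where U: "open U" "U \<inter> return_times act Y = {0}"
    using assms(4) by (auto simp: discrete_def isolated_in_def)
  then have "0 \<in> U" by blast
  obtain \<phi> :: "'g \<Rightarrow> real" where \<phi>: "continuous_on UNIV \<phi>" "\<And>g. 0 < \<phi> g"
    "\<And>P g. separated U P \<Longrightarrow> integrable (count_space P) (\<lambda>p. \<phi> (- p + g))"
    "\<And>P. separated U P \<Longrightarrow> continuous_on UNIV (\<lambda>g. \<integral>p. \<phi> (- p + g) \<partial>count_space P)"
    by (rule weight_function[OF assms(1) U(1) \<open>0 \<in> U\<close>]) (rule that, assumption+)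
  interpret separated_transverse_system act M Y U \<phi>
    using assms(1,3) U \<open>0 \<in> U\<close> \<phi> countable_discrete[OF assms(4)]
    by unfold_locales (simp_all add: Int_commute)
  show ?thesis
    using discrete_coboundary_imp_continuous by (intro allI inj_on_discretization) auto
qed

end
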